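(* Let $\mathbf{k}$ be an algebraically closed field of characteristic $0$. Let $\phi =(ax+ P(y), by+c ) \in \mathbb{J}_n$ be such that $\deg P(y)=n$. Suppose neither $a$ nor $b$ is a root of unity, and let $\tilde{x},\tilde{y},h_1$ be the polynomials associated with $\phi$ in the context. Then the following are true: (i) Suppose that $h_1=0$, and that there exist nonzero integers $r_1$ and $r_2$ such that $a^{r_1}=b^{r_2}$. Let $r_1, r_2$ be the least such pair, and $r_1=ds_1$, $r_2=d s_2$ where $d=\gcd(r_1, r_2)$. Then $\mathrm{Supp}\,\mathfrak{I}_{\phi} = \mathbb{A}^2$, and $\mathfrak{I}_{\phi}$ is generated by some unions of the fibers of the $\phi$-equivariant map $\mathbb{A}^2 \dashrightarrow \mathbb{P}^1$, $(x,y) \mapsto [\tilde{x}^{s_1}: \tilde{y}^{s_2}]$, and the unique fixed point $\tilde{x}=\tilde{y}=0$. (ii) Suppose that $h_1=0$, and that there exist no nonzero integers $r_1$ and $r_2$ such that $a^{r_1}=b^{r_2}$. Then $\mathfrak{I}_{\phi}$ is finite, and is generated by three elements: the curve $\tilde{x}=0$, the line $\tilde{y}=0$, and the unique fixed point $\tilde{x}=\tilde{y}=0$. (iii) Suppose $h_1\neq 0$. Then $\mathfrak{I}_{\phi}$ is finite, and is generated by two elements: the line $\tilde{y}=0$, and the unique fixed point $\tilde{x}=\tilde{y}=0$.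
   Context: $\mathbb{J}_n=\{(ax+P(y),by+c): a,b\in\mathbf{k}^\times,\ c\in\mathbf{k},\ P\in\mathbf{k}[y],\ \deg P\le n\}\subset\mathrm{Aut}(\mathbb{A}^2)$, acting on $\mathbb{A}^2=\mathrm{Spec}\,\mathbf{k}[x,y]$. Associated polynomials (here $b\ne1$): put $\tilde{y}=y-\frac{c}{1-b}$ and write $P(y)=\sum_{i=0}^n\tilde{a}_i\tilde{y}^i$. Then $$\tilde{x}=x-\sum_{0\le i\le n,\ a\neq b^i}\frac{\tilde{a}_i}{b^i-a}\tilde{y}^i,\qquad h_1(y)=\sum_{0\le i\le n,\ a=b^i}\tilde{a}_i\tilde{y}^i .$$ A variety is reduced but not necessarily irreducible, connected or pure dimensional. Invariant subvariety lattice: $\mathfrak{I}_\phi$ is the set of all closed subvarieties of $\mathbb{A}^2$ invariant under $\langle\phi\rangle$ (including $\emptyset$ and $\mathbb{A}^2$). Its support $\mathrm{Supp}\,\mathfrak{I}_\phi$ is the union of all $Y\in\mathfrak{I}_\phi$ with $Y\neq \mathbb{A}^2$. A subset $\mathcal{I}\subset\mathfrak{I}_\phi$ generates $\mathfrak{I}_\phi$ if every element of $\mathfrak{I}_\phi$ except $\mathbb{A}^2$ is a union of elements of $\mathcal{I}$. "Generated by some unions of fibers" means that the corresponding members of the generating subset are elements of $\mathfrak{I}_\phi$ that are unions of fibers. The map $[\tilde{x}^{s_1}:\tilde{y}^{s_2}]$ is identified with the rational function $\tilde{x}^{s_1}/\tilde{y}^{s_2}$; its fibers are taken as strict transforms,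 i.e. closures in $\mathbb{A}^2$ of the fibers on the domain of definition (with reduced structure). A rational map $\pi:\mathbb{A}^2\dashrightarrow\mathbb{P}^1$ is $\phi$-equivariant if there is $\overline\phi\in\mathrm{Aut}(\mathbb{P}^1)$ with $\pi\circ\phi=\overline\phi\circ\pi$. The "least" pair $(r_1,r_2)$ is a generator of the rank-one group of integer pairs satisfying $a^{r_1}=b^{r_2}$.
   Formalization: In (i), if s_1 and s_2 have opposite signs, the curve x̃=0 and the line ỹ=0 are added to the generators: they are invariant but not unions of fibers, as together they form one fiber (e.g. a=2, b=1/2, c=0, P=1, map x̃ỹ), so the claim as worded fails there. *)

theory Defs
  imports
    "HOL-Computational_Algebra.Computational_Algebra"
begin

section \<open>Polynomials and closed subvarieties of the affine plane\<close>

text \<open>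
  The ring k[x,y] is rendered as \<^typ>\<open>'a poly poly\<close>: the outer variable is x, the coefficients are
  polynomials in y. The ground field is algebraically closed, so a closed subvariety (reduced,
  possibly reducible) is identified with its set of k-points in \<^typ>\<open>'a \<times> 'a\<close>.
\<close>

definition bieval :: "'a::comm_ring_1 poly poly \<Rightarrow> 'a \<times> 'a \<Rightarrow> 'a" where
  "bieval F p = poly (poly F [:fst p:]) (snd p)"

definition vanishing :: "'a::comm_ring_1 poly poly set \<Rightarrow> ('a \<times> 'a) set" where
  "vanishing S = {p. \<forall>F\<in>S. bieval F p = 0}"

definition zclosed :: "('a::comm_ring_1 \<times> 'a) set \<Rightarrow> bool" where
  "zclosed Y \<longleftrightarrow> (\<exists>S. Y = vanishing S)"

definition zclosure :: "('a::comm_ring_1 \<times> 'a) set \<Rightarrow> ('a \<times> 'a) set" where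
  "zclosure Y = \<Inter>{Z. zclosed Z \<and> Y \<subseteq> Z}"


section \<open>The automorphism and its associated polynomials\<close>

definition jonq :: "'a::comm_ring_1 \<Rightarrow> 'a \<Rightarrow> 'a \<Rightarrow> 'a poly \<Rightarrow> 'a \<times> 'a \<Rightarrow> 'a \<times> 'a" where
  "jonq a b c P = (\<lambda>(x, y). (a * x + poly P y, b * y + c))"

definition ytil :: "'a::field \<Rightarrow> 'a \<Rightarrow> 'a poly" where
  "ytil b c = [:- (c / (1 - b)), 1:]"

text \<open>The coefficients of P in powers of \<open>ytil b c\<close>; see \<open>expansion_ytil\<close> below.\<close>

definition atil :: "'a::field \<Rightarrow> 'a \<Rightarrow> 'a poly \<Rightarrow> nat \<Rightarrow> 'a" where
  "atil b c P i = coeff (pcompose P [:c / (1 - b), 1:]) i"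

lemma pcompose_monom: "pcompose (monom r i) q = smult r (q ^ i)"
  for q :: "'a::comm_ring_1 poly"
  by (induction i) (simp_all add: monom_0 monom_Suc pcompose_pCons)

lemma expansion_ytil:
  assumes "degree P \<le> n"
  shows "P = (\<Sum>i\<le>n. smult (atil b c P i) (ytil b c ^ i))"
proof -
  let ?Q = "pcompose P [:c / (1 - b), 1:]"
  have "degree ?Q \<le> n"
    using assms by (simp add: degree_pcompose)
  then have "?Q = (\<Sum>i\<le>n. monom (coeff ?Q i) i)"
    by (simp add: poly_as_sum_of_monoms')
  then have "pcompose ?Q (ytil b c) = pcompose (\<Sum>i\<le>n. monom (coeff ?Q i) i) (ytil b c)"
    by (rule arg_cong)
  also have "\<dots> = (\<Sum>i\<le>n. smult (atil b c P i) (ytil b c ^ i))"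
    by (simp add: pcompose_sum pcompose_monom atil_def)
  finally have "pcompose ?Q (ytil b c) = (\<Sum>i\<le>n. smult (atil b c P i) (ytil b c ^ i))" .
  moreover have "pcompose ?Q (ytil b c) = P"
    by (simp add: pcompose_assoc [symmetric] pcompose_pCons ytil_def)
  ultimately show ?thesis by simp
qed

definition xtilde :: "nat \<Rightarrow> 'a::field \<Rightarrow> 'a \<Rightarrow> 'a \<Rightarrow> 'a poly \<Rightarrow> 'a poly poly" where
  "xtilde n a b c P =
    [:0, 1:] - [:\<Sum>i | i \<le> n \<and> a \<noteq> b ^ i. smult (atil b c P i / (b ^ i - a)) (ytil b c ^ i):]"

definition ytilde :: "'a::field \<Rightarrow> 'a \<Rightarrow> 'a poly poly" where
  "ytilde b c = [:ytil b c:]"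

definition h1 :: "nat \<Rightarrow> 'a::field \<Rightarrow> 'a \<Rightarrow> 'a \<Rightarrow> 'a poly \<Rightarrow> 'a poly" where
  "h1 n a b c P = (\<Sum>i | i \<le> n \<and> a = b ^ i. smult (atil b c P i) (ytil b c ^ i))"


section \<open>The lattice of invariant subvarieties\<close>

definition cyclic_group :: "('p \<Rightarrow> 'p) \<Rightarrow> ('p \<Rightarrow> 'p) set" where
  "cyclic_group \<phi> = range (\<lambda>m. \<phi> ^^ m) \<union> range (\<lambda>m. inv \<phi> ^^ m)"

definition invariant_lattice ::
    "('a::comm_ring_1 \<times> 'a \<Rightarrow> 'a \<times> 'a) \<Rightarrow> ('a \<times> 'a) set set" where
  "invariant_lattice \<phi> = {Y. zclosed Y \<and> (\<forall>g\<in>cyclic_group \<phi>. g ` Y = Y)}"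

definition lattice_support :: "('a::comm_ring_1 \<times> 'a \<Rightarrow> 'a \<times> 'a) \<Rightarrow> ('a \<times> 'a) set" where
  "lattice_support \<phi> = \<Union>{Y \<in> invariant_lattice \<phi>. Y \<noteq> UNIV}"

text \<open>The empty set is the empty union.\<close>

definition generates_lattice ::
    "('a::comm_ring_1 \<times> 'a) set set \<Rightarrow> ('a \<times> 'a \<Rightarrow> 'a \<times> 'a) \<Rightarrow> bool" where
  "generates_lattice \<I> \<phi> \<longleftrightarrow>
    \<I> \<subseteq> invariant_lattice \<phi> \<and>
    (\<forall>Y\<in>invariant_lattice \<phi>. Y \<noteq> UNIV \<longrightarrow> (\<exists>\<C>\<subseteq>\<I>. Y = \<Union>\<C>))"

definition is_unique_fixed_point :: "('p \<Rightarrow> 'p) \<Rightarrow> 'p set \<Rightarrow> bool" where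
  "is_unique_fixed_point \<phi> F \<longleftrightarrow> (\<exists>p. F = {p} \<and> {q. \<phi> q = q} = {p})"


section \<open>Rational maps to the projective line and their fibers\<close>

definition proj_point :: "'a::field \<times> 'a \<Rightarrow> ('a \<times> 'a) set" where
  "proj_point = (\<lambda>(u, v). {(t * u, t * v) | t. t \<noteq> 0})"

definition proj_line :: "('a::field \<times> 'a) set set" where
  "proj_line = proj_point ` (UNIV - {(0, 0)})"

definition aut_proj_line :: "(('a::field \<times> 'a) set \<Rightarrow> ('a \<times> 'a) set) set" where
  "aut_proj_line = {\<psi>. \<exists>p q r s. p * s - q * r \<noteq> 0 \<and>
     (\<forall>u v. (u, v) \<noteq> (0, 0) \<longrightarrow>
        \<psi> (proj_point (u, v)) = proj_point (p * u + q * v, r * u + s * v))}"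

text \<open>
  A rational function f in k(x,y) is regarded as a rational map to the projective line. It is defined
  at p, with value \<open>[F(p) : G(p)]\<close>, whenever some representation f = F/G has F and G not both zero
  at p.
\<close>

definition rat_map_value ::
    "'a::field poly poly fract \<Rightarrow> 'a \<times> 'a \<Rightarrow> ('a \<times> 'a) set \<Rightarrow> bool" where
  "rat_map_value f p q \<longleftrightarrow>
    (\<exists>F G. G \<noteq> 0 \<and> f = Fract F G \<and> (bieval F p, bieval G p) \<noteq> (0, 0) \<and>
           q = proj_point (bieval F p, bieval G p))"

text \<open>
  Equality of two rational maps is tested at the points where both are defined.
\<close>

definition equivariant_map ::
    "('a::field \<times> 'a \<Rightarrow> 'a \<times> 'a) \<Rightarrow> 'a poly poly fract \<Rightarrow> bool" where
  "equivariant_map \<phi> f \<longleftrightarrow>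
    (\<exists>\<psi>\<in>aut_proj_line. \<forall>p q q'.
       rat_map_value f p q \<longrightarrow> rat_map_value f (\<phi> p) q' \<longrightarrow> q' = \<psi> q)"

definition fiber :: "'a::field poly poly fract \<Rightarrow> ('a \<times> 'a) set \<Rightarrow> ('a \<times> 'a) set" where
  "fiber f q = zclosure {p. rat_map_value f p q}"

definition union_of_fibers :: "'a::field poly poly fract \<Rightarrow> ('a \<times> 'a) set \<Rightarrow> bool" where
  "union_of_fibers f Y \<longleftrightarrow> (\<exists>Q\<subseteq>proj_line. Y = \<Union>(fiber f ` Q))"

text \<open>
  The map \<open>[F^s1 : G^s2]\<close>, with integer exponents of arbitrary sign. If s1 and s2 have opposite
  signs, one of its two special fibers is empty, and the other is the zero locus of the product
  F G. When F and G are \<open>xtilde\<close> and \<open>ytilde\<close>, both components of that fiber are invariant, but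
  neither is a union of fibers, so they have to be listed separately among the generators.
\<close>

definition monomial_map ::
    "'a::field poly poly \<Rightarrow> 'a poly poly \<Rightarrow> int \<Rightarrow> int \<Rightarrow> 'a poly poly fract" where
  "monomial_map F G s1 s2 = (to_fract F powi s1) / (to_fract G powi s2)"

text \<open>
  The least pair generates the group of all pairs with \<open>a^m1 = b^m2\<close>. It is determined up to
  a common sign, and changing the sign only swaps the two homogeneous coordinates of the map above.
\<close>

definition least_relation :: "'a::field \<Rightarrow> 'a \<Rightarrow> int \<Rightarrow> int \<Rightarrow> bool" where
  "least_relation a b r1 r2 \<longleftrightarrow>
    {(m1, m2). a powi m1 = b powi m2} = range (\<lambda>k. (k * r1, k * r2))"

end

theory Submission
  imports Defs
begin

text \<open>
  In the coordinates \<open>(u, v)\<close> given by \<open>xt\<close> and \<open>yt\<close> the automorphism becomes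
  \<open>(u, v) \<mapsto> (a u + h v, b v)\<close>, where \<open>h\<close> is \<open>h1\<close> in the new coordinate: it is zero, or a nonzero multiple of
  \<open>v ^ i\<close> with \<open>a = b ^ i\<close>. In all cases \<open>h (b v) = a * h v\<close>, and the N-th iterate is
  \<open>(a ^ N * (u + N * h v / a), b ^ N * v)\<close>.

  The proof determines a large algebraic group that preserves every invariant closed set. If a
  polynomial vanishes along an orbit, its values there form an exponential polynomial
  \<open>\<Sum>\<mu>. \<mu> ^ N * G \<mu> N\<close> in N, the bases being the numbers \<open>a ^ k * b ^ j\<close>; all coefficients \<open>G \<mu>\<close> must be
  zero (\<open>exponential_polynomial_eq_0\<close>). It follows that an invariant closed set is stable under the maps
  \<open>(u, v) \<mapsto> (\<xi> (u + T h v), \<eta> v)\<close> for all scalars T and all \<open>(\<xi>, \<eta>)\<close> in the torus cut out by the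
  multiplicative relations between a and b (\<open>zclosed_invariant_saturated\<close>). The lattice
  can then be read off from the orbits of this group.

  If \<open>h1 \<noteq> 0\<close>, the dense set \<open>v \<noteq> 0\<close> is one orbit, and the line \<open>v = 0\<close> consists of two further
  ones. If \<open>h1 = 0\<close> and there is no relation, the torus is two-dimensional and its orbits are the
  complement of the axes, the punctured axes and the origin.

  If \<open>h1 = 0\<close> and \<open>a powi (d * s1) = b powi (d * s2)\<close> is the least relation, the torus contains the group
  \<open>\<xi> powi s1 = \<eta> powi s2\<close>, which acts transitively on the fibers of \<open>xt powi s1 / yt powi s2\<close> off the axes.
  When \<open>s1\<close> and \<open>s2\<close> have the same sign, all fibers pass through the origin, and an invariant closed
  set with a point other than the origin is itself a union of fibers (\<open>union_of_fibers_same_sign\<close>). When the signs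
  differ, the map is a monomial or the inverse of one; a proper invariant closed set meets the
  complement of the axes in finitely many fibers, which are closed (\<open>off_axes_union_of_fibers\<close>), and
  the axes and the origin are treated separately.
\<close>


section \<open>Plane polynomials restricted to curves\<close>

lemma bieval_simps [simp]:
  "bieval (F + G) p = bieval F p + bieval G p"
  "bieval (F - G) p = bieval F p - bieval G p"
  "bieval (F * G) p = bieval F p * bieval G p"
  "bieval (F ^ m) p = bieval F p ^ m"
  "bieval 0 p = 0" "bieval 1 p = 1"
  "bieval (smult q F) p = poly q (snd p) * bieval F p"
  "bieval [:q:] p = poly q (snd p)"
  "bieval [:q, r:] p = poly q (snd p) + fst p * poly r (snd p)"
  by (simp_all add: bieval_def poly_power)

lemma bieval_sum [simp]: "bieval (sum f I) p = (\<Sum>i\<in>I. bieval (f i) p)"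
  by (induction I rule: infinite_finite_induct) simp_all

lemma bieval_prod [simp]: "bieval (prod f I) p = (\<Prod>i\<in>I. bieval (f i) p)"
  by (induction I rule: infinite_finite_induct) simp_all

abbreviation bidegrees :: "'a::comm_ring_1 poly poly \<Rightarrow> (nat \<times> nat) set" where
  "bidegrees F \<equiv> SIGMA k:{..degree F}. {..degree (coeff F k)}"

lemma bieval_eq_sum:
  "bieval F (u, v) = (\<Sum>(k, j)\<in>bidegrees F. coeff (coeff F k) j * u ^ k * v ^ j)"
proof -
  have "bieval F (u, v) = (\<Sum>k\<le>degree F. poly (coeff F k) v * u ^ k)"
    by (simp add: bieval_def poly_altdef[of F] poly_sum poly_power)
  also have "\<dots> = (\<Sum>k\<le>degree F. \<Sum>j\<le>degree (coeff F k). coeff (coeff F k) j * u ^ k * v ^ j)"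
    by (simp add: poly_altdef sum_distrib_left sum_distrib_right mult_ac)
  finally show ?thesis
    by (simp add: sum.Sigma)
qed

text \<open>
  Polynomial functions are stable under substitution of polynomials; this makes preimages of closed
  sets under polynomial maps closed.
\<close>

lemma bieval_compose: "\<exists>H. \<forall>p. bieval H p = bieval F (bieval A p, bieval B p)"
proof
  show "\<forall>p. bieval (\<Sum>(k, j)\<in>bidegrees F. [:[:coeff (coeff F k) j:]:] * A ^ k * B ^ j) p
      = bieval F (bieval A p, bieval B p)"
    by (simp add: bieval_eq_sum[of F "bieval A p" "bieval B p" for p] case_prod_unfold mult.assoc)
qed

lemma bieval_on_curve: "\<exists>R. \<forall>t. poly R t = bieval F (poly A t, poly B t)"
proof
  show "\<forall>t. poly (\<Sum>(k, j)\<in>bidegrees F. smult (coeff (coeff F k) j) (A ^ k * B ^ j)) t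
      = bieval F (poly A t, poly B t)"
    by (simp add: bieval_eq_sum case_prod_unfold poly_sum poly_power mult_ac)
qed

lemma zclosed_vanishing [simp]: "zclosed (vanishing S)"
  by (auto simp: zclosed_def)

lemma zclosed_zero_set: "zclosed {p. bieval F p = 0}"
  using zclosed_vanishing[of "{F}"] by (simp add: vanishing_def)

lemma zclosed_vimage:
  assumes "zclosed Y" and "\<And>p. \<sigma> p = (bieval A p, bieval B p)"
  shows "zclosed (\<sigma> -` Y)"
proof -
  obtain S where S: "Y = vanishing S"
    using assms(1) by (auto simp: zclosed_def)
  obtain H where H: "\<And>F p. bieval (H F) p = bieval F (\<sigma> p)"
    using bieval_compose[of _ A B] assms(2) by metis
  have "\<sigma> -` Y = vanishing (H ` S)"
    by (auto simp: S vanishing_def H)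
  then show ?thesis by simp
qed

text \<open>
  The one geometric fact used about closed sets: along a polynomially parametrized curve the equations of
  Z become polynomials in one variable, which have finitely many roots unless they vanish.
  Density arguments and limits of orbits are all reduced to suitable curves.
\<close>

lemma zclosed_contains_curve:
  fixes A B :: "'a::field poly"
  assumes "zclosed Z" and "infinite {t. (poly A t, poly B t) \<in> Z}"
  shows "(poly A t, poly B t) \<in> Z"
proof -
  obtain S where S: "Z = vanishing S"
    using assms(1) by (auto simp: zclosed_def)
  have "bieval F (poly A t, poly B t) = 0" if "F \<in> S" for F
  proof -
    obtain R where R: "\<And>t. poly R t = bieval F (poly A t, poly B t)"
      using bieval_on_curve by metis
    have "{t. (poly A t, poly B t) \<in> Z} \<subseteq> {t. poly R t = 0}"
      using that by (auto simp: R S vanishing_def)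
    then have "R = 0"
      using assms(2) poly_roots_finite finite_subset by blast
    then show ?thesis using R[of t] by simp
  qed
  then show ?thesis by (auto simp: S vanishing_def)
qed

lemma zclosed_contains_punctured_curve:
  fixes A B :: "'a::field_char_0 poly"
  assumes "zclosed Z" and "\<And>t. t \<noteq> 0 \<Longrightarrow> (poly A t, poly B t) \<in> Z"
  shows "(poly A t, poly B t) \<in> Z"
proof (rule zclosed_contains_curve[OF assms(1)])
  have "- {0} \<subseteq> {t. (poly A t, poly B t) \<in> Z}"
    using assms(2) by auto
  moreover have "infinite (- {0::'a})"
    by (simp add: infinite_UNIV_char_0 Compl_eq_Diff_UNIV infinite_remove)
  ultimately show "infinite {t. (poly A t, poly B t) \<in> Z}"
    using finite_subset by blast
qed

lemma zclosed_dense: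
  fixes Z :: "('a::field_char_0 \<times> 'a) set"
  assumes Z: "zclosed Z" and off: "\<And>u v. u \<noteq> 0 \<Longrightarrow> v \<noteq> 0 \<Longrightarrow> (u, v) \<in> Z"
  shows "Z = UNIV"
proof -
  have "(u, v) \<in> Z" if "v \<noteq> 0" for u v
    using zclosed_contains_punctured_curve[OF Z, of "[:0, 1:]" "[:v:]" u] off that by simp
  then have "(u, v) \<in> Z" for u v
    using zclosed_contains_punctured_curve[OF Z, of "[:u:]" "[:0, 1:]" v] by simp
  then show ?thesis by auto
qed


section \<open>Exponential polynomials and invariant closed sets\<close>

lemma coeff_shift_top:
  fixes p :: "'a::field poly"
  assumes "degree p \<le> d"
  shows "coeff (pcompose p [:1, 1:]) d = coeff p d"
proof (cases "degree p = d")
  case True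
  have "lead_coeff (pcompose p [:1, 1:]) = lead_coeff p"
    by (subst lead_coeff_comp) simp_all
  then show ?thesis by (simp add: degree_pcompose flip: True)
next
  case False
  then show ?thesis using assms by (simp add: coeff_eq_0 degree_pcompose)
qed

text \<open>
  Linear independence of the sequences \<open>N \<mapsto> \<mu> ^ N * N ^ k\<close>. The proof picks one base \<open>\<kappa>\<close> and
  applies the operator \<open>f \<mapsto> (N \<mapsto> f (N + 1) - \<kappa> * f N)\<close>, which lowers the degree of the coefficient of
  \<open>\<kappa> ^ N\<close> and acts injectively on the coefficients of the other bases. The degree of \<open>G \<kappa>\<close> is
  exhausted by an inner induction, after which \<open>\<kappa>\<close> disappears from the sum.
\<close>

lemma exponential_polynomial_eq_0:
  fixes G :: "'a::field_char_0 \<Rightarrow> 'a poly"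
  assumes "finite L" and "0 \<notin> L"
    and "\<And>N. (\<Sum>\<mu>\<in>L. \<mu> ^ N * poly (G \<mu>) (of_nat N)) = 0"
  shows "\<forall>\<mu>\<in>L. G \<mu> = 0"
  using assms
proof (induction L arbitrary: G rule: finite_induct)
  case empty
  then show ?case by simp
next
  case (insert \<kappa> L)
  have "\<forall>\<mu>\<in>insert \<kappa> L. G \<mu> = 0"
    if "\<forall>k\<ge>d. coeff (G \<kappa>) k = 0"
      and "\<forall>N. (\<Sum>\<mu>\<in>insert \<kappa> L. \<mu> ^ N * poly (G \<mu>) (of_nat N)) = 0" for d and G :: "'a \<Rightarrow> 'a poly"
    using that
  proof (induction d arbitrary: G)
    case 0
    then have "G \<kappa> = 0" by (simp add: poly_eq_iff)
    then show ?case using 0 insert by simp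
  next
    case (Suc d)
    define S where "S N = (\<Sum>\<mu>\<in>insert \<kappa> L. \<mu> ^ N * poly (G \<mu>) (of_nat N))" for N
    \<comment> \<open>The coefficients after applying the operator to the sum.\<close>
    define D where "D \<mu> = smult \<mu> (pcompose (G \<mu>) [:1, 1:]) - smult \<kappa> (G \<mu>)" for \<mu>
    have deg: "degree (G \<kappa>) \<le> d"
      using Suc.prems(1) by (intro degree_le) auto
    have "coeff (D \<kappa>) k = 0" if "k \<ge> d" for k
      using coeff_shift_top[of "G \<kappa>" k] deg that by (simp add: D_def)
    moreover have "(\<Sum>\<mu>\<in>insert \<kappa> L. \<mu> ^ N * poly (D \<mu>) (of_nat N)) = S (Suc N) - \<kappa> * S N" for N
      by (simp only: S_def D_def sum_distrib_left flip: sum_subtractf)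
        (intro sum.cong refl, simp add: poly_pcompose algebra_simps)
    ultimately have D: "\<forall>\<mu>\<in>insert \<kappa> L. D \<mu> = 0"
      using Suc.prems(2) by (intro Suc.IH) (simp_all only: S_def, auto)
    have L0: "G \<mu> = 0" if "\<mu> \<in> L" for \<mu>
    proof -
      have "coeff (D \<mu>) (degree (G \<mu>)) = (\<mu> - \<kappa>) * lead_coeff (G \<mu>)"
        using coeff_shift_top[of "G \<mu>" "degree (G \<mu>)"] by (simp add: D_def algebra_simps)
      moreover have "\<mu> \<noteq> \<kappa>" using that insert by auto
      ultimately show ?thesis using D that by simp
    qed
    have "poly (G \<kappa>) (of_nat N) = 0" for N
    proof -
      have "(\<Sum>\<mu>\<in>insert \<kappa> L. \<mu> ^ N * poly (G \<mu>) (of_nat N)) = \<kappa> ^ N * poly (G \<kappa>) (of_nat N)"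
        using insert.hyps L0 by simp
      then show ?thesis using Suc.prems(2) insert.prems(1) by auto
    qed
    then have "range of_nat \<subseteq> {x. poly (G \<kappa>) x = 0}" by auto
    moreover have "infinite (range (of_nat :: nat \<Rightarrow> 'a))"
      by (simp add: finite_image_iff)
    ultimately have "G \<kappa> = 0"
      using poly_roots_finite finite_subset by blast
    then show ?case using L0 by auto
  qed
  from this[of "Suc (degree (G \<kappa>))" G] show ?case
    using insert.prems(2) by (simp add: coeff_eq_0)
qed

text \<open>
  The N-th iterate of the map \<open>(u, v) \<mapsto> (a u + h v, b v)\<close> is
  \<open>(u, v) \<mapsto> (a ^ N * (u + N * h v / a), b ^ N * v)\<close>. Hence an equation F of Z, evaluated along an orbit,
  is an exponential polynomial with bases \<open>a ^ k * b ^ j\<close>, and each of its coefficients is the zero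
  polynomial. Evaluating these coefficients at \<open>T * a\<close> and recombining them with the weights
  \<open>\<xi> ^ k * \<eta> ^ j\<close> gives the value of F at the asserted point. Thus stability under a single map
  extends to a whole family of maps with independent parameters T and \<open>(\<xi>, \<eta>)\<close>.
\<close>

lemma zclosed_invariant_saturated:
  fixes a b u v \<xi> \<eta> T :: "'a::field_char_0" and h :: "'a \<Rightarrow> 'a"
  assumes Z: "zclosed Z" and inv: "\<And>u v. (u, v) \<in> Z \<Longrightarrow> (a * u + h v, b * v) \<in> Z"
    and h: "\<And>v. h (b * v) = a * h v" and ab: "a \<noteq> 0" "b \<noteq> 0"
    and p: "(u, v) \<in> Z"
    and char: "\<And>k j k' j'. a ^ k * b ^ j = a ^ k' * b ^ j' \<Longrightarrow> \<xi> ^ k * \<eta> ^ j = \<xi> ^ k' * \<eta> ^ j'"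
  shows "(\<xi> * (u + T * h v), \<eta> * v) \<in> Z"
proof -
  obtain r where r: "h v = a * r"
    using ab(1) by (metis nonzero_mult_div_cancel_left times_divide_eq_right)
  define q where "q = [:u, r:]"
  have hpow: "h (b ^ N * v) = a ^ N * h v" for N
    by (induction N) (simp_all add: h mult.assoc)
  have orbit: "(a ^ N * poly q (of_nat N), b ^ N * v) \<in> Z" for N
  proof (induction N)
    case 0
    then show ?case using p by (simp add: q_def)
  next
    case (Suc N)
    have "a * (a ^ N * poly q (of_nat N)) + h (b ^ N * v) = a ^ Suc N * poly q (of_nat (Suc N))"
      unfolding hpow by (simp add: q_def r algebra_simps)
    then show ?case using inv[OF Suc] by (simp add: mult.assoc)
  qed
  obtain S where S: "Z = vanishing S"
    using Z by (auto simp: zclosed_def)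
  have "bieval F (\<xi> * (u + T * h v), \<eta> * v) = 0" if F: "F \<in> S" for F
  proof -
    let ?I = "bidegrees F"
    define w where "w = (\<lambda>(k, j). a ^ k * b ^ j)"
    define m where "m = (\<lambda>(k, j). smult (coeff (coeff F k) j * v ^ j) (q ^ k))"
    \<comment> \<open>The part of F in which the iterates contribute the factor \<open>\<mu> ^ N\<close>, as a polynomial in N.\<close>
    define G where "G \<mu> = (\<Sum>i\<in>{i\<in>?I. w i = \<mu>}. m i)" for \<mu>
    have fin: "finite ?I" by simp
    have "(\<Sum>\<mu>\<in>w ` ?I. \<mu> ^ N * poly (G \<mu>) (of_nat N)) = 0" for N
    proof -
      have "(\<Sum>\<mu>\<in>w ` ?I. \<mu> ^ N * poly (G \<mu>) (of_nat N))
          = (\<Sum>\<mu>\<in>w ` ?I. \<Sum>i\<in>{i\<in>?I. w i = \<mu>}. w i ^ N * poly (m i) (of_nat N))"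
        by (simp add: G_def poly_sum sum_distrib_left)
      also have "\<dots> = (\<Sum>i\<in>?I. w i ^ N * poly (m i) (of_nat N))"
        by (rule sum.image_gen[symmetric, OF fin])
      also have "\<dots> = bieval F (a ^ N * poly q (of_nat N), b ^ N * v)"
        by (simp add: bieval_eq_sum w_def m_def case_prod_unfold poly_power power_mult_distrib
            power_mult[symmetric] mult_ac)
      also have "\<dots> = 0"
        using orbit F by (auto simp: S vanishing_def)
      finally show ?thesis .
    qed
    then have G0: "\<forall>\<mu>\<in>w ` ?I. G \<mu> = 0"
      by (intro exponential_polynomial_eq_0) (use ab in \<open>auto simp: w_def\<close>)
    \<comment> \<open>By hypothesis the new weights depend on the monomial only through its old weight.\<close>
    define \<chi> where "\<chi> = (\<lambda>(k, j). \<xi> ^ k * \<eta> ^ j)"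
    have "bieval F (\<xi> * (u + T * h v), \<eta> * v) = (\<Sum>i\<in>?I. \<chi> i * poly (m i) (T * a))"
      by (simp add: bieval_eq_sum m_def \<chi>_def q_def r case_prod_unfold poly_power
          power_mult_distrib mult_ac)
    also have "\<dots> = (\<Sum>\<mu>\<in>w ` ?I. \<Sum>i\<in>{i\<in>?I. w i = \<mu>}. \<chi> i * poly (m i) (T * a))"
      by (rule sum.image_gen[OF fin])
    also have "\<dots> = 0"
    proof (rule sum.neutral, rule ballI)
      fix \<mu> assume "\<mu> \<in> w ` ?I"
      then obtain i0 where i0: "i0 \<in> ?I" "w i0 = \<mu>" by auto
      have "\<chi> i = \<chi> i0" if "w i = \<mu>" for i
        using char[of "fst i" "snd i" "fst i0" "snd i0"] that i0(2)
        by (simp add: \<chi>_def w_def case_prod_unfold)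
      then have "(\<Sum>i\<in>{i\<in>?I. w i = \<mu>}. \<chi> i * poly (m i) (T * a)) = \<chi> i0 * poly (G \<mu>) (T * a)"
        by (simp add: G_def poly_sum sum_distrib_left)
      then show "(\<Sum>i\<in>{i\<in>?I. w i = \<mu>}. \<chi> i * poly (m i) (T * a)) = 0"
        using G0 \<open>\<mu> \<in> w ` ?I\<close> by simp
    qed
    finally show ?thesis .
  qed
  then show ?thesis by (auto simp: S vanishing_def)
qed


section \<open>Values and fibers of rational maps to the projective line\<close>

lemma mem_fiberI: "rat_map_value f p q \<Longrightarrow> p \<in> fiber f q"
  by (auto simp: fiber_def zclosure_def)

lemma fiber_subsetI:
  assumes "zclosed Y" and "\<And>p. rat_map_value f p q \<Longrightarrow> p \<in> Y"
  shows "fiber f q \<subseteq> Y"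
  unfolding fiber_def zclosure_def using assms by (intro Inter_lower) blast

lemma proj_point_eq_iff:
  assumes "(u, v) \<noteq> (0, 0)" and "(u', v') \<noteq> (0, 0)"
  shows "proj_point (u, v) = proj_point (u', v') \<longleftrightarrow> u * v' = u' * v"
proof
  assume eq: "proj_point (u, v) = proj_point (u', v')"
  have "(u, v) \<in> proj_point (u, v)"
    by (auto simp: proj_point_def intro: exI[of _ 1])
  then show "u * v' = u' * v"
    unfolding eq by (auto simp: proj_point_def)
next
  assume cross: "u * v' = u' * v"
  obtain s where s: "u' = s * u" "v' = s * v"
  proof (cases "u = 0")
    case True
    then show ?thesis using assms cross that[of "v' / v"] by auto
  next
    case False
    then show ?thesis using cross that[of "u' / u"] by (auto simp: field_simps)
  qed
  then have "s \<noteq> 0" using assms(2) by auto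
  have "(t * u, t * v) \<in> proj_point (u', v')" if "t \<noteq> 0" for t
    using \<open>s \<noteq> 0\<close> that by (auto simp: proj_point_def s intro!: exI[of _ "t / s"])
  moreover have "(t * u', t * v') \<in> proj_point (u, v)" if "t \<noteq> 0" for t
    using \<open>s \<noteq> 0\<close> that by (auto simp: proj_point_def s intro!: exI[of _ "t * s"])
  ultimately show "proj_point (u, v) = proj_point (u', v')"
    by (fastforce simp: proj_point_def)
qed

lemma proj_point_in_proj_line: "(u, v) \<noteq> (0, 0) \<Longrightarrow> proj_point (u, v) \<in> proj_line"
  by (auto simp: proj_line_def)

text \<open>
  The value does not depend on the representation, because two representations have proportional
  value vectors. So one representation without a common zero at p settles the question there.
\<close>

lemma rat_map_value_iff:
  assumes f: "f = Fract F G" "G \<noteq> 0" and p: "(bieval F p, bieval G p) \<noteq> (0, 0)"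
  shows "rat_map_value f p q \<longleftrightarrow> q = proj_point (bieval F p, bieval G p)"
proof
  assume "rat_map_value f p q"
  then obtain F' G' where *: "G' \<noteq> 0" "f = Fract F' G'" "(bieval F' p, bieval G' p) \<noteq> (0, 0)"
    "q = proj_point (bieval F' p, bieval G' p)"
    by (auto simp: rat_map_value_def)
  then have "F' * G = F * G'"
    using f by (simp add: eq_fract)
  then have "bieval F' p * bieval G p = bieval F p * bieval G' p"
    by (metis bieval_simps(3))
  then show "q = proj_point (bieval F p, bieval G p)"
    using proj_point_eq_iff[OF *(3) p] *(4) by simp
next
  assume "q = proj_point (bieval F p, bieval G p)"
  then show "rat_map_value f p q"
    using assms by (auto simp: rat_map_value_def)
qed

lemma swap_proj_point: "prod.swap ` proj_point (u, v) = proj_point (v, u)"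
  by (auto simp: proj_point_def image_iff)

text \<open>
  Inverting f exchanges the two homogeneous coordinates, which changes neither its system of fibers
  nor its equivariance. This reduces exponents \<open>(s1, s2)\<close> to the case \<open>s1 > 0\<close>.
\<close>

lemma rat_map_value_inverse:
  assumes "f \<noteq> 0"
  shows "rat_map_value (inverse f) p q \<longleftrightarrow> rat_map_value f p (prod.swap ` q)"
proof -
  have *: "rat_map_value (inverse f) p (prod.swap ` q)" if val: "rat_map_value f p q" and "f \<noteq> 0"
    for f :: "'a poly poly fract" and q
  proof -
    obtain F G where FG: "G \<noteq> 0" "f = Fract F G" "(bieval F p, bieval G p) \<noteq> (0, 0)"
      "q = proj_point (bieval F p, bieval G p)"
      using val unfolding rat_map_value_def by blast
    have "F \<noteq> 0" using FG(2) that(2) by (auto simp: fract_collapse)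
    moreover have "inverse f = Fract G F" using FG(2) by simp
    ultimately show ?thesis
      using FG(3,4) by (auto simp: rat_map_value_def swap_proj_point)
  qed
  have "prod.swap ` prod.swap ` q = q" by (simp add: image_image)
  then show ?thesis using *[of "inverse f" q] *[of f "prod.swap ` q"] assms by auto
qed

lemma swap_proj_line: "q \<in> proj_line \<Longrightarrow> prod.swap ` q \<in> proj_line"
  by (auto simp: proj_line_def swap_proj_point intro!: imageI)

lemma union_of_fibers_inverse:
  assumes "f \<noteq> 0" and "union_of_fibers f Y"
  shows "union_of_fibers (inverse f) Y"
proof -
  obtain Q where Q: "Q \<subseteq> proj_line" "Y = \<Union>(fiber f ` Q)"
    using assms(2) by (auto simp: union_of_fibers_def)
  have "fiber (inverse f) (prod.swap ` q) = fiber f q" for q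
    using rat_map_value_inverse[OF assms(1)] by (simp add: fiber_def image_image)
  then have "Y = \<Union>(fiber (inverse f) ` (image prod.swap) ` Q)"
    using Q(2) by (simp add: image_image)
  moreover have "(image prod.swap) ` Q \<subseteq> proj_line"
    using Q(1) swap_proj_line by auto
  ultimately show ?thesis
    unfolding union_of_fibers_def by blast
qed

lemma equivariant_map_inverse:
  assumes "f \<noteq> 0" and "equivariant_map \<phi> f"
  shows "equivariant_map \<phi> (inverse f)"
proof -
  obtain \<psi> where \<psi>: "\<psi> \<in> aut_proj_line"
    "\<And>p q q'. rat_map_value f p q \<Longrightarrow> rat_map_value f (\<phi> p) q' \<Longrightarrow> q' = \<psi> q"
    using assms(2) by (auto simp: equivariant_map_def)
  define \<psi>' where "\<psi>' q = prod.swap ` \<psi> (prod.swap ` q)" for q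
  obtain p q r s where det: "p * s - q * r \<noteq> 0" and
    act: "\<And>u v. (u, v) \<noteq> (0, 0) \<Longrightarrow> \<psi> (proj_point (u, v)) = proj_point (p * u + q * v, r * u + s * v)"
    using \<psi>(1) by (auto simp: aut_proj_line_def)
  have "\<psi>' (proj_point (u, v)) = proj_point (s * u + r * v, q * u + p * v)" if "(u, v) \<noteq> (0, 0)" for u v
  proof -
    have "\<psi> (proj_point (v, u)) = proj_point (p * v + q * u, r * v + s * u)"
      using that by (intro act) auto
    then show ?thesis by (simp only: \<psi>'_def swap_proj_point add.commute)
  qed
  moreover have "s * p - r * q \<noteq> 0" using det by (simp add: mult.commute)
  ultimately have "\<psi>' \<in> aut_proj_line" by (auto simp: aut_proj_line_def)
  moreover have "q' = \<psi>' q"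
    if "rat_map_value (inverse f) p q" "rat_map_value (inverse f) (\<phi> p) q'" for p q q'
  proof -
    have "prod.swap ` q' = \<psi> (prod.swap ` q)"
      using that \<psi>(2) by (simp add: rat_map_value_inverse[OF assms(1)])
    then have "prod.swap ` prod.swap ` q' = \<psi>' q" by (simp add: \<psi>'_def)
    then show ?thesis by (simp add: image_image)
  qed
  ultimately show ?thesis unfolding equivariant_map_def by blast
qed

lemma diagonal_aut_proj_line:
  fixes \<alpha> \<beta> :: "'a::field"
  assumes "\<alpha> \<noteq> 0" "\<beta> \<noteq> 0"
  obtains \<psi> where "\<psi> \<in> aut_proj_line" "\<And>u v. \<psi> (proj_point (u, v)) = proj_point (\<alpha> * u, \<beta> * v)"
proof -
  define \<psi> where "\<psi> = image (\<lambda>(x, y). (\<alpha> * x, \<beta> * y))"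
  have act: "\<psi> (proj_point (u, v)) = proj_point (\<alpha> * u, \<beta> * v)" for u v
    by (force simp: \<psi>_def proj_point_def mult_ac)
  have "\<psi> \<in> aut_proj_line"
    unfolding aut_proj_line_def
    by (rule CollectI, rule exI[of _ \<alpha>], rule exI[of _ 0], rule exI[of _ 0], rule exI[of _ \<beta>])
      (use assms act in simp)
  then show ?thesis using act that by blast
qed

lemma monomial_map_uminus: "monomial_map F G (- s) (- s') = inverse (monomial_map F G s s')"
  by (simp add: monomial_map_def power_int_minus divide_inverse)

lemma to_fract_power: "to_fract F ^ m = to_fract (F ^ m)"
  by (induction m) simp_all

lemma monomial_map_same_sign:
  "G \<noteq> 0 \<Longrightarrow> monomial_map F G (int m) (int m') = Fract (F ^ m) (G ^ m')"
  by (simp add: monomial_map_def to_fract_power) (simp add: to_fract_def)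

lemma monomial_map_opposite_sign:
  "monomial_map F G (int m) (- int m') = Fract (F ^ m * G ^ m') 1"
  by (simp add: monomial_map_def power_int_minus to_fract_power divide_inverse flip: to_fract_mult)
    (simp add: to_fract_def)


section \<open>Invariant lattices of bijections\<close>

lemma bij_image_eqI:
  assumes "bij g" and "\<And>p. g p \<in> Y \<longleftrightarrow> p \<in> Y"
  shows "g ` Y = Y"
proof
  show "Y \<subseteq> g ` Y"
  proof
    fix p assume "p \<in> Y"
    moreover obtain p' where "p = g p'" using assms(1) by (meson bij_pointE)
    ultimately show "p \<in> g ` Y" using assms(2) by auto
  qed
qed (use assms(2) in auto)

lemma invariant_lattice_iff:
  assumes "bij \<phi>"
  shows "Y \<in> invariant_lattice \<phi> \<longleftrightarrow> zclosed Y \<and> (\<forall>p. \<phi> p \<in> Y \<longleftrightarrow> p \<in> Y)"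
proof (intro iffI conjI)
  assume Y: "Y \<in> invariant_lattice \<phi>"
  then show "zclosed Y" by (simp add: invariant_lattice_def)
  have "\<phi> ^^ 1 \<in> cyclic_group \<phi>" unfolding cyclic_group_def by blast
  then have "\<phi> ` Y = Y" using Y by (auto simp: invariant_lattice_def)
  then show "\<forall>p. \<phi> p \<in> Y \<longleftrightarrow> p \<in> Y"
    using bij_is_inj[OF assms] by (metis inj_image_mem_iff)
next
  assume *: "zclosed Y \<and> (\<forall>p. \<phi> p \<in> Y \<longleftrightarrow> p \<in> Y)"
  then have mem: "\<phi> p \<in> Y \<longleftrightarrow> p \<in> Y" for p by blast
  then have inv_mem: "inv \<phi> p \<in> Y \<longleftrightarrow> p \<in> Y" for p
    by (metis assms bij_inv_eq_iff)
  have "(\<phi> ^^ m) p \<in> Y \<longleftrightarrow> p \<in> Y" for m p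
    by (induction m) (simp_all add: mem)
  moreover have "(inv \<phi> ^^ m) p \<in> Y \<longleftrightarrow> p \<in> Y" for m p
    by (induction m) (simp_all add: inv_mem)
  ultimately have "\<forall>g\<in>cyclic_group \<phi>. g ` Y = Y"
    unfolding cyclic_group_def
    by (auto intro!: bij_image_eqI bij_fn[OF assms] bij_fn[OF bij_imp_bij_inv[OF assms]]
        simp del: image_eqI)
  then show "Y \<in> invariant_lattice \<phi>" using * by (simp add: invariant_lattice_def)
qed

text \<open>
  The generators contained in Y have union Y once each point of Y lies in one of them. So it is enough
  to follow the orbit of a single point.
\<close>

lemma generates_latticeI:
  assumes "\<I> \<subseteq> invariant_lattice \<phi>"
    and "\<And>Y p. Y \<in> invariant_lattice \<phi> \<Longrightarrow> Y \<noteq> UNIV \<Longrightarrow> p \<in> Y \<Longrightarrow> \<exists>W\<in>\<I>. p \<in> W \<and> W \<subseteq> Y"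
  shows "generates_lattice \<I> \<phi>"
  unfolding generates_lattice_def
proof (intro conjI ballI impI)
  fix Y assume "Y \<in> invariant_lattice \<phi>" "Y \<noteq> UNIV"
  then have "Y = \<Union>{W \<in> \<I>. W \<subseteq> Y}" using assms(2) by blast
  then show "\<exists>\<C>\<subseteq>\<I>. Y = \<Union>\<C>" by (metis (no_types, lifting) mem_Collect_eq subsetI)
qed (rule assms(1))

lemma finite_invariant_lattice:
  assumes "finite \<I>" and "generates_lattice \<I> \<phi>"
  shows "finite (invariant_lattice \<phi>)"
proof (rule finite_subset)
  show "invariant_lattice \<phi> \<subseteq> insert UNIV (Union ` Pow \<I>)"
    using assms(2) by (fastforce simp: generates_lattice_def)
qed (use assms(1) in simp)


section \<open>Automorphisms in normal form\<close>

text \<open>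
  The polynomial map \<open>\<sigma>\<close>, with components A and B, is the inverse of the coordinate system
  \<open>(xt, yt)\<close>, so that \<open>\<sigma> (u, v)\<close> is the point with new coordinates u and v. The functional
  equation of h says that the shear \<open>u \<mapsto> u + h v / a\<close> commutes with the diagonal part of the map, which
  makes the iterates explicit.
\<close>

locale normalized_jonq =
  fixes a b :: "'a::{alg_closed_field, field_char_0}"
    and h :: "'a \<Rightarrow> 'a"
    and \<phi> \<sigma> :: "'a \<times> 'a \<Rightarrow> 'a \<times> 'a"
    and xt yt A B :: "'a poly poly"
  assumes nonzero: "a \<noteq> 0" "b \<noteq> 0"
    and a_not_root: "\<And>m. m > 0 \<Longrightarrow> a ^ m \<noteq> 1"
    and b_not_root: "\<And>m. m > 0 \<Longrightarrow> b ^ m \<noteq> 1"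
    and h_semi: "\<And>v. h (b * v) = a * h v"
    and \<sigma>_poly: "\<And>p. \<sigma> p = (bieval A p, bieval B p)"
    and xt_\<sigma> [simp]: "\<And>u v. bieval xt (\<sigma> (u, v)) = u"
    and yt_\<sigma> [simp]: "\<And>u v. bieval yt (\<sigma> (u, v)) = v"
    and \<sigma>_xt_yt: "\<And>p. \<sigma> (bieval xt p, bieval yt p) = p"
    and \<phi>_\<sigma>: "\<And>u v. \<phi> (\<sigma> (u, v)) = \<sigma> (a * u + h v, b * v)"
begin

lemma chart_cases:
  obtains u v where "p = \<sigma> (u, v)"
  using \<sigma>_xt_yt by metis

lemma \<sigma>_eq_iff [simp]: "\<sigma> (u, v) = \<sigma> (u', v') \<longleftrightarrow> u = u' \<and> v = v'"
  by (metis xt_\<sigma> yt_\<sigma>)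

lemma all_chart: "(\<forall>p. R p) \<longleftrightarrow> (\<forall>u v. R (\<sigma> (u, v)))"
  by (metis \<sigma>_xt_yt)

lemma bij_\<phi>: "bij \<phi>"
proof (rule bijI)
  show "inj \<phi>"
  proof (rule injI)
    fix p p' assume eq: "\<phi> p = \<phi> p'"
    obtain u v where p: "p = \<sigma> (u, v)" by (rule chart_cases)
    obtain u' v' where p': "p' = \<sigma> (u', v')" by (rule chart_cases)
    show "p = p'"
      using eq nonzero by (auto simp: p p' \<phi>_\<sigma>)
  qed
  show "surj \<phi>"
  proof (rule surjI)
    fix p
    show "\<phi> (\<sigma> ((bieval xt p - h (bieval yt p / b)) / a, bieval yt p / b)) = p"
      using nonzero by (simp add: \<phi>_\<sigma> \<sigma>_xt_yt)
  qed
qed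

lemma lattice_iff:
  "Y \<in> invariant_lattice \<phi> \<longleftrightarrow>
    zclosed Y \<and> (\<forall>u v. \<sigma> (a * u + h v, b * v) \<in> Y \<longleftrightarrow> \<sigma> (u, v) \<in> Y)"
  unfolding invariant_lattice_iff[OF bij_\<phi>] all_chart by (simp add: \<phi>_\<sigma>)

lemma zclosed_chart: "zclosed Y \<Longrightarrow> zclosed (\<sigma> -` Y)"
  by (rule zclosed_vimage[OF _ \<sigma>_poly])

lemma chart_punctured_curve:
  assumes "zclosed Y" and "\<And>t. t \<noteq> 0 \<Longrightarrow> \<sigma> (poly F t, poly G t) \<in> Y"
  shows "\<sigma> (poly F t, poly G t) \<in> Y"
  using zclosed_contains_punctured_curve[OF zclosed_chart[OF assms(1)], of F G t] assms(2) by simp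

lemma chart_dense:
  assumes "zclosed Y" and "\<And>u v. u \<noteq> 0 \<Longrightarrow> v \<noteq> 0 \<Longrightarrow> \<sigma> (u, v) \<in> Y"
  shows "Y = UNIV"
proof -
  have "\<sigma> -` Y = UNIV"
    using assms by (intro zclosed_dense zclosed_chart) auto
  then show ?thesis
    by (metis \<sigma>_xt_yt UNIV_I UNIV_eq_I vimage_eq)
qed

lemma mem_vanishing [simp]:
  "\<sigma> (u, v) \<in> vanishing {xt} \<longleftrightarrow> u = 0"
  "\<sigma> (u, v) \<in> vanishing {yt} \<longleftrightarrow> v = 0"
  "\<sigma> (u, v) \<in> vanishing {xt, yt} \<longleftrightarrow> u = 0 \<and> v = 0"
  by (simp_all add: vanishing_def)

lemma h_0 [simp]: "h 0 = 0"
proof -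
  have "h 0 * 1 = h 0 * a" using h_semi[of 0] by (simp add: mult.commute)
  then show ?thesis using a_not_root[of 1] by auto
qed

lemma origin_eq: "vanishing {xt, yt} = {\<sigma> (0, 0)}"
proof -
  have "p \<in> vanishing {xt, yt} \<longleftrightarrow> p = \<sigma> (0, 0)" for p
    by (rule chart_cases[of p]) simp
  then show ?thesis by blast
qed

lemma unique_fixed_point: "is_unique_fixed_point \<phi> (vanishing {xt, yt})"
proof -
  have "\<phi> p = p \<longleftrightarrow> p = \<sigma> (0, 0)" for p
  proof -
    obtain u v where p: "p = \<sigma> (u, v)" by (rule chart_cases)
    show ?thesis
      using a_not_root[of 1] b_not_root[of 1] by (auto simp: p \<phi>_\<sigma>)
  qed
  then show ?thesis
    by (auto simp: is_unique_fixed_point_def origin_eq)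
qed

lemma origin_in_lattice: "vanishing {xt, yt} \<in> invariant_lattice \<phi>"
  using nonzero by (auto simp: lattice_iff)

lemma y_zero_in_lattice: "vanishing {yt} \<in> invariant_lattice \<phi>"
  using nonzero by (auto simp: lattice_iff)

lemma x_zero_in_lattice:
  assumes "\<And>v. h v = 0"
  shows "vanishing {xt} \<in> invariant_lattice \<phi>"
  using nonzero assms by (auto simp: lattice_iff)

text \<open>
  The Zariski closure of the group generated by \<open>(a, b)\<close> in the two-dimensional torus: all pairs that
  satisfy the multiplicative relations of \<open>(a, b)\<close>. Natural exponents are used because the relations
  enter through coincidences between weights of monomials.
\<close>

definition torus :: "('a \<times> 'a) set" where
  "torus = {(\<xi>, \<eta>). \<xi> \<noteq> 0 \<and> \<eta> \<noteq> 0 \<and>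
     (\<forall>k j k' j'. a ^ k * b ^ j = a ^ k' * b ^ j' \<longrightarrow> \<xi> ^ k * \<eta> ^ j = \<xi> ^ k' * \<eta> ^ j')}"

lemma torusI:
  assumes "\<xi> \<noteq> 0" "\<eta> \<noteq> 0"
    and "\<And>k j k' j'. a ^ k * b ^ j = a ^ k' * b ^ j' \<Longrightarrow> \<xi> ^ k * \<eta> ^ j = \<xi> ^ k' * \<eta> ^ j'"
  shows "(\<xi>, \<eta>) \<in> torus"
  unfolding torus_def using assms by blast

lemma torusD:
  assumes "(\<xi>, \<eta>) \<in> torus" and "a ^ k * b ^ j = a ^ k' * b ^ j'"
  shows "\<xi> ^ k * \<eta> ^ j = \<xi> ^ k' * \<eta> ^ j'"
  using assms unfolding torus_def by blast

lemma lattice_saturated: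
  assumes "Y \<in> invariant_lattice \<phi>" and "\<sigma> (u, v) \<in> Y" and "(\<xi>, \<eta>) \<in> torus"
  shows "\<sigma> (\<xi> * (u + T * h v), \<eta> * v) \<in> Y"
proof -
  have "(\<xi> * (u + T * h v), \<eta> * v) \<in> \<sigma> -` Y"
  proof (rule zclosed_invariant_saturated[where a = a and b = b])
    show "zclosed (\<sigma> -` Y)" using assms(1) by (intro zclosed_chart) (simp add: lattice_iff)
    show "(a * u + h v, b * v) \<in> \<sigma> -` Y" if "(u, v) \<in> \<sigma> -` Y" for u v
      using that assms(1) by (simp add: lattice_iff)
    show "\<xi> ^ k * \<eta> ^ j = \<xi> ^ k' * \<eta> ^ j'" if "a ^ k * b ^ j = a ^ k' * b ^ j'" for k j k' j'
      by (rule torusD[OF assms(3) that])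
  qed (use assms(2) nonzero h_semi in auto)
  then show ?thesis by simp
qed

lemma lattice_torus:
  assumes "Y \<in> invariant_lattice \<phi>" and "\<sigma> (u, v) \<in> Y" and "(\<xi>, \<eta>) \<in> torus"
  shows "\<sigma> (\<xi> * u, \<eta> * v) \<in> Y"
  using lattice_saturated[OF assms, of 0] by simp

text \<open>
  If the torus moves u freely, then a point of an axis other than the origin sweeps out the punctured
  axis, whose closure contains the origin.
\<close>

lemma y_zero_subset:
  assumes Y: "Y \<in> invariant_lattice \<phi>" "\<sigma> (u, 0) \<in> Y" "u \<noteq> 0"
    and torus: "\<And>\<xi>. \<xi> \<noteq> 0 \<Longrightarrow> \<exists>\<eta>. (\<xi>, \<eta>) \<in> torus"
  shows "vanishing {yt} \<subseteq> Y"
proof -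
  have "\<sigma> (t, 0) \<in> Y" if t: "t \<noteq> 0" for t
  proof -
    obtain \<eta> where "(t / u, \<eta>) \<in> torus" using torus[of "t / u"] t Y(3) by auto
    from lattice_torus[OF Y(1,2) this] show ?thesis using Y(3) by simp
  qed
  then have *: "\<sigma> (t, 0) \<in> Y" for t
    using chart_punctured_curve[of Y "[:0, 1:]" 0 t] Y(1) by (simp add: lattice_iff)
  show ?thesis
  proof
    fix p assume p: "p \<in> vanishing {yt}"
    show "p \<in> Y" by (rule chart_cases[of p]) (use p * in auto)
  qed
qed

lemma x_zero_subset:
  assumes Y: "Y \<in> invariant_lattice \<phi>" "\<sigma> (0, v) \<in> Y" "v \<noteq> 0"
    and torus: "\<And>\<eta>. \<eta> \<noteq> 0 \<Longrightarrow> \<exists>\<xi>. (\<xi>, \<eta>) \<in> torus"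
  shows "vanishing {xt} \<subseteq> Y"
proof -
  have "\<sigma> (0, t) \<in> Y" if t: "t \<noteq> 0" for t
  proof -
    obtain \<xi> where "(\<xi>, t / v) \<in> torus" using torus[of "t / v"] t Y(3) by auto
    from lattice_torus[OF Y(1,2) this] show ?thesis using Y(3) by simp
  qed
  then have *: "\<sigma> (0, t) \<in> Y" for t
    using chart_punctured_curve[of Y 0 "[:0, 1:]" t] Y(1) by (simp add: lattice_iff)
  show ?thesis
  proof
    fix p assume p: "p \<in> vanishing {xt}"
    show "p \<in> Y" by (rule chart_cases[of p]) (use p * in auto)
  qed
qed

subsection \<open>Multiplicative relations between the eigenvalues\<close>

lemma powi_eq_1: "a powi m = 1 \<Longrightarrow> m = 0" "b powi m = 1 \<Longrightarrow> m = 0"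
proof -
  have *: "m = 0" if z: "z powi m = 1" "\<And>k. k > 0 \<Longrightarrow> z ^ k \<noteq> 1" for z :: 'a and m
  proof (rule ccontr)
    assume "m \<noteq> 0"
    have "z ^ nat \<bar>m\<bar> = 1"
      using z(1) by (auto simp: power_int_def abs_if power_inverse split: if_splits)
    then show False using z(2)[of "nat \<bar>m\<bar>"] \<open>m \<noteq> 0\<close> by simp
  qed
  show "a powi m = 1 \<Longrightarrow> m = 0" "b powi m = 1 \<Longrightarrow> m = 0"
    using *[of a m] *[of b m] a_not_root b_not_root by auto
qed

lemma b_powi_inj: "b powi m = b powi m' \<Longrightarrow> m = m'"
  using powi_eq_1(2)[of "m - m'"] nonzero by (simp add: power_int_diff)

lemma power_relation_iff:
  "a ^ k * b ^ j = a ^ k' * b ^ j' \<longleftrightarrow> a powi (int k - int k') = b powi (int j' - int j)"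
  using nonzero by (simp add: power_int_diff field_simps)

lemma torus_independent:
  assumes "\<not> (\<exists>m1 m2. m1 \<noteq> 0 \<and> m2 \<noteq> 0 \<and> a powi m1 = b powi m2)" and "\<xi> \<noteq> 0" "\<eta> \<noteq> 0"
  shows "(\<xi>, \<eta>) \<in> torus"
proof -
  have "k = k' \<and> j = j'" if "a ^ k * b ^ j = a ^ k' * b ^ j'" for k j k' j'
  proof -
    have rel: "a powi (int k - int k') = b powi (int j' - int j)"
      using that by (simp add: power_relation_iff)
    then have "int k - int k' = 0 \<or> int j' - int j = 0" using assms(1) by blast
    then have "int k - int k' = 0 \<and> int j' - int j = 0"
      using rel powi_eq_1 by force
    then show ?thesis by simp
  qed
  then show ?thesis using assms(2,3) by (intro torusI) blast+
qed

lemma torus_power: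
  assumes "a = b ^ i" and "\<eta> \<noteq> 0"
  shows "(\<eta> ^ i, \<eta>) \<in> torus"
proof (rule torusI)
  fix k j k' j' assume rel: "a ^ k * b ^ j = a ^ k' * b ^ j'"
  have "b ^ (i * k + j) = b ^ (i * k' + j')"
    using rel by (simp add: assms(1) power_add power_mult)
  then have "int (i * k + j) = int (i * k' + j')"
    by (intro b_powi_inj) (simp only: power_int_of_nat)
  then have "\<eta> ^ (i * k + j) = \<eta> ^ (i * k' + j')"
    by (simp only: of_nat_eq_iff)
  then show "(\<eta> ^ i) ^ k * \<eta> ^ j = (\<eta> ^ i) ^ k' * \<eta> ^ j'"
    by (simp add: power_add power_mult)
qed (use assms(2) in simp_all)

lemma torus_least_relation:
  assumes least: "least_relation a b (d * s1) (d * s2)"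
    and "\<xi> \<noteq> 0" "\<eta> \<noteq> 0" and eq: "\<xi> powi s1 = \<eta> powi s2"
  shows "(\<xi>, \<eta>) \<in> torus"
proof -
  have "\<xi> ^ k * \<eta> ^ j = \<xi> ^ k' * \<eta> ^ j'" if "a ^ k * b ^ j = a ^ k' * b ^ j'" for k j k' j'
  proof -
    have "(int k - int k', int j' - int j) \<in> range (\<lambda>t. (t * (d * s1), t * (d * s2)))"
      using that least by (auto simp: power_relation_iff least_relation_def)
    then obtain t where "int k - int k' = s1 * (d * t)" "int j' - int j = s2 * (d * t)"
      by (auto simp: mult_ac)
    then have "\<xi> powi (int k - int k') = \<eta> powi (int j' - int j)"
      by (simp only: power_int_mult eq)
    then show ?thesis using assms(2,3) by (simp add: power_int_diff field_simps)
  qed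
  then show ?thesis using assms(2,3) by (intro torusI) blast+
qed

text \<open>
  The first component determines the second, as b is not a root of unity. So the group of relations
  embeds into the integers and is generated by the relation with least positive first component.
\<close>

lemma least_relation_exists:
  assumes "m1 \<noteq> 0" "m2 \<noteq> 0" "a powi m1 = b powi m2"
  shows "\<exists>r1 r2. least_relation a b r1 r2"
proof -
  define R where "R k \<longleftrightarrow> k > 0 \<and> (\<exists>m. a powi (int k) = b powi m)" for k :: nat
  have neg: "a powi (- m) = b powi (- m')" if "a powi m = b powi m'" for m m'
    using that by (simp add: power_int_minus)
  have "R (nat \<bar>m1\<bar>)"
    using assms neg[OF assms(3)] by (auto simp: R_def abs_if)
  then have R: "R (LEAST k. R k)" by (rule LeastI)
  define r1 where "r1 = int (LEAST k. R k)"
  have "r1 > 0" using R by (simp add: r1_def R_def)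
  obtain r2 where r2: "a powi r1 = b powi r2" using R by (auto simp: R_def r1_def)
  have mult: "a powi (k * r1) = b powi (k * r2)" for k
    using r2 by (metis mult.commute power_int_mult)
  have "\<exists>k. m = k * r1 \<and> m' = k * r2" if rel: "a powi m = b powi m'" for m m'
  proof -
    define k where "k = m div r1"
    have "a powi (m mod r1) = b powi (m' - k * r2)"
      using rel mult[of k] nonzero
      by (simp add: k_def power_int_diff flip: minus_div_mult_eq_mod)
    moreover have "m mod r1 < r1" "m mod r1 \<ge> 0" using \<open>r1 > 0\<close> by simp_all
    moreover from this have "\<not> R (nat (m mod r1))"
      by (intro not_less_Least) (simp add: r1_def nat_less_iff)
    ultimately have "m mod r1 = 0"
      unfolding R_def by (metis nat_0_le of_nat_0_less_iff order_le_less)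
    then have "m = k * r1"
      unfolding k_def by (metis div_mult_mod_eq add.right_neutral)
    moreover have "m' = k * r2"
      using b_powi_inj[of m' "k * r2"] rel mult[of k] \<open>m = k * r1\<close> by simp
    ultimately show ?thesis by blast
  qed
  then have "least_relation a b r1 r2"
    unfolding least_relation_def using mult by (fastforce simp: image_iff)
  then show ?thesis by blast
qed

subsection \<open>Finite lattices\<close>

text \<open>
  Without relations the torus is everything, and it has four orbits in the plane: the complement of
  the axes, which is dense, the two punctured axes, and the origin.
\<close>

lemma generated_by_axes_and_origin:
  assumes "\<And>v. h v = 0"
    and "\<not> (\<exists>m1 m2. m1 \<noteq> 0 \<and> m2 \<noteq> 0 \<and> a powi m1 = b powi m2)"
  shows "generates_lattice {vanishing {xt}, vanishing {yt}, vanishing {xt, yt}} \<phi>"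
proof (rule generates_latticeI)
  show "{vanishing {xt}, vanishing {yt}, vanishing {xt, yt}} \<subseteq> invariant_lattice \<phi>"
    using assms(1) x_zero_in_lattice y_zero_in_lattice origin_in_lattice by simp
  fix Y p assume Y: "Y \<in> invariant_lattice \<phi>" "Y \<noteq> UNIV" "p \<in> Y"
  have torus: "(\<xi>, \<eta>) \<in> torus" if "\<xi> \<noteq> 0" "\<eta> \<noteq> 0" for \<xi> \<eta>
    using torus_independent[OF assms(2) that] .
  obtain u v where p: "p = \<sigma> (u, v)" by (rule chart_cases)
  have "\<not> (u \<noteq> 0 \<and> v \<noteq> 0)"
  proof
    assume uv: "u \<noteq> 0 \<and> v \<noteq> 0"
    have "\<sigma> (u', v') \<in> Y" if "u' \<noteq> 0" "v' \<noteq> 0" for u' v'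
      using lattice_torus[OF Y(1) _ torus, of u v "u' / u" "v' / v"] Y(3) uv that by (simp add: p)
    then show False using chart_dense Y(1,2) by (simp add: lattice_iff)
  qed
  then consider "u = 0" "v = 0" | "u = 0" "v \<noteq> 0" | "u \<noteq> 0" "v = 0" by blast
  then show "\<exists>W\<in>{vanishing {xt}, vanishing {yt}, vanishing {xt, yt}}. p \<in> W \<and> W \<subseteq> Y"
  proof cases
    case 1
    then show ?thesis using Y(3) by (simp add: p origin_eq)
  next
    case 2
    then have "vanishing {xt} \<subseteq> Y"
      using x_zero_subset[OF Y(1) _ 2(2)] torus[of 1] Y(3) by (simp add: p) blast
    then show ?thesis using 2 by (simp add: p)
  next
    case 3
    then have "vanishing {yt} \<subseteq> Y"
      using y_zero_subset[OF Y(1) _ 3(1)] torus[of _ 1] Y(3) by (simp add: p) blast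
    then show ?thesis using 3 by (simp add: p)
  qed
qed

text \<open>
  Here the shears \<open>u \<mapsto> u + T * h v\<close> together with the torus elements \<open>(\<eta> ^ i, \<eta>)\<close> act transitively on the
  dense set \<open>v \<noteq> 0\<close>, so a proper invariant set lies on the line \<open>v = 0\<close>.
\<close>

lemma generated_by_y_axis_and_origin:
  assumes "a = b ^ i" and h: "\<And>v. v \<noteq> 0 \<Longrightarrow> h v \<noteq> 0"
  shows "generates_lattice {vanishing {yt}, vanishing {xt, yt}} \<phi>"
proof (rule generates_latticeI)
  show "{vanishing {yt}, vanishing {xt, yt}} \<subseteq> invariant_lattice \<phi>"
    using y_zero_in_lattice origin_in_lattice by simp
  fix Y p assume Y: "Y \<in> invariant_lattice \<phi>" "Y \<noteq> UNIV" "p \<in> Y"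
  have "i > 0" using assms(1) a_not_root[of 1] by (cases i) auto
  then have torus: "\<exists>\<eta>. (\<xi>, \<eta>) \<in> torus" if "\<xi> \<noteq> 0" for \<xi>
  proof -
    obtain \<eta> where "\<eta> ^ i = \<xi>" using nth_root_exists[OF \<open>i > 0\<close>] by blast
    then show ?thesis using torus_power[OF assms(1), of \<eta>] that \<open>i > 0\<close> by auto
  qed
  obtain u v where p: "p = \<sigma> (u, v)" by (rule chart_cases)
  have "v = 0"
  proof (rule ccontr)
    assume v: "v \<noteq> 0"
    have "\<sigma> (u', v') \<in> Y" if "v' \<noteq> 0" for u' v'
    proof -
      define \<eta> where "\<eta> = v' / v"
      have "\<eta> \<noteq> 0" using v that by (simp add: \<eta>_def)
      define T where "T = (u' / \<eta> ^ i - u) / h v"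
      have "\<eta> ^ i * (u + T * h v) = u'" "\<eta> * v = v'"
        using \<open>\<eta> \<noteq> 0\<close> v h[OF v] by (simp_all add: T_def \<eta>_def)
      then show ?thesis
        using lattice_saturated[OF Y(1) _ torus_power[OF assms(1) \<open>\<eta> \<noteq> 0\<close>], of u v T] Y(3)
        by (simp add: p)
    qed
    then show False using chart_dense Y(1,2) by (simp add: lattice_iff)
  qed
  show "\<exists>W\<in>{vanishing {yt}, vanishing {xt, yt}}. p \<in> W \<and> W \<subseteq> Y"
  proof (cases "u = 0")
    case True
    then show ?thesis using Y(3) \<open>v = 0\<close> by (simp add: p origin_eq)
  next
    case False
    then have "vanishing {yt} \<subseteq> Y"
      using y_zero_subset[OF Y(1) _ False torus] Y(3) \<open>v = 0\<close> by (simp add: p)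
    then show ?thesis using \<open>v = 0\<close> by (simp add: p)
  qed
qed

lemma distinct_generators:
  "card {vanishing {xt}, vanishing {yt}, vanishing {xt, yt}} = 3"
  "card {vanishing {yt}, vanishing {xt, yt}} = 2"
proof -
  have "vanishing {xt} \<noteq> vanishing {yt}" "vanishing {yt} \<noteq> vanishing {xt, yt}"
    "vanishing {xt} \<noteq> vanishing {xt, yt}"
    using mem_vanishing[of 0 1] mem_vanishing[of 1 0] by fastforce+
  then show "card {vanishing {xt}, vanishing {yt}, vanishing {xt, yt}} = 3"
    "card {vanishing {yt}, vanishing {xt, yt}} = 2" by simp_all
qed

subsection \<open>Resonant diagonal automorphisms\<close>

lemma xt_yt_nonzero: "xt \<noteq> 0" "yt \<noteq> 0"
proof -
  show "xt \<noteq> 0"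
  proof
    assume "xt = 0"
    then have "bieval xt (\<sigma> (1, 0)) = 0" by simp
    then show False by simp
  qed
  show "yt \<noteq> 0"
  proof
    assume "yt = 0"
    then have "bieval yt (\<sigma> (0, 1)) = 0" by simp
    then show False by simp
  qed
qed

lemma proper_zero_set_in_lattice:
  assumes h: "\<And>v. h v = 0" and c: "c \<noteq> 0"
    and semi: "\<And>u v. bieval F (\<sigma> (a * u, b * v)) = c * bieval F (\<sigma> (u, v))"
    and p: "bieval F p = 0" and F: "bieval F p' \<noteq> 0"
  shows "p \<in> lattice_support \<phi>"
proof -
  have "{q. bieval F q = 0} \<in> invariant_lattice \<phi>"
    using h semi c by (simp add: lattice_iff zclosed_zero_set)
  moreover have "{q. bieval F q = 0} \<noteq> UNIV" using F by auto
  ultimately show ?thesis using p unfolding lattice_support_def by blast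
qed

text \<open>
  The point \<open>(u, v)\<close> with \<open>u \<noteq> 0\<close> lies on the curve \<open>x ^ m * v ^ n = y ^ n * u ^ m\<close>, whose equation is an
  eigenvector because x and y contribute the same factor.
\<close>

lemma support_same_sign:
  assumes h: "\<And>v. h v = 0" and rel: "a ^ m = b ^ n" and pos: "m > 0" "n > 0"
  shows "lattice_support \<phi> = UNIV"
proof -
  have "\<sigma> (u, v) \<in> lattice_support \<phi>" for u v
  proof (cases "u = 0")
    case True
    show ?thesis
      by (rule proper_zero_set_in_lattice[OF h, where F = xt and c = a and p' = "\<sigma> (1, 0)"])
        (use True nonzero in simp_all)
  next
    case False
    show ?thesis
      by (rule proper_zero_set_in_lattice[OF h,
            where F = "xt ^ m * [:[:v ^ n:]:] - yt ^ n * [:[:u ^ m:]:]" and c = "a ^ m" and p' = "\<sigma> (0, 1)"])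
        (use False nonzero pos in \<open>simp_all add: rel zero_power power_mult_distrib algebra_simps\<close>)
  qed
  then show ?thesis by (metis UNIV_eq_I \<sigma>_xt_yt)
qed

text \<open>
  Now the monomial \<open>x ^ m * y ^ n\<close> is an invariant function, and its level sets cover the plane.
\<close>

lemma support_opposite_sign:
  assumes h: "\<And>v. h v = 0" and rel: "a ^ m * b ^ n = 1" and pos: "m > 0" "n > 0"
  shows "lattice_support \<phi> = UNIV"
proof -
  have "\<sigma> (u, v) \<in> lattice_support \<phi>" for u v
  proof -
    \<comment> \<open>A value attained by the monomial outside of the level set, to see that the latter is proper.\<close>
    obtain w :: 'a where w: "w \<noteq> u ^ m * v ^ n" "w \<noteq> 0"
      using infinite_UNIV_char_0[where ?'a = 'a] finite_subset[of UNIV "{u ^ m * v ^ n, 0}"] by blast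
    obtain w' where w': "w' ^ m = w" using nth_root_exists[OF pos(1)] by blast
    have semi: "(a * u') ^ m * (b * v') ^ n = u' ^ m * v' ^ n" for u' v'
    proof -
      have "(a * u') ^ m * (b * v') ^ n = (a ^ m * b ^ n) * (u' ^ m * v' ^ n)"
        by (simp add: power_mult_distrib mult_ac)
      then show ?thesis using rel by simp
    qed
    show ?thesis
      by (rule proper_zero_set_in_lattice[OF h,
            where F = "xt ^ m * yt ^ n - [:[:u ^ m * v ^ n:]:]" and c = 1 and p' = "\<sigma> (w', 1)"])
        (use w w' semi in simp_all)
  qed
  then show ?thesis by (metis UNIV_eq_I \<sigma>_xt_yt)
qed

text \<open>
  The origin is an indeterminacy point. For a representation F/G of the map,
  \<open>xt ^ m * G = F * yt ^ n\<close>, so F vanishes on the punctured axis \<open>u = 0\<close> and G on the punctured axis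
  \<open>v = 0\<close>; by continuity along these lines both vanish at the origin.
\<close>

lemma value_same_sign:
  assumes pos: "m > 0" "n > 0"
  shows "rat_map_value (Fract (xt ^ m) (yt ^ n)) (\<sigma> (u, v)) q \<longleftrightarrow>
    (u, v) \<noteq> (0, 0) \<and> q = proj_point (u ^ m, v ^ n)"
proof (cases "(u, v) = (0, 0)")
  case False
  then show ?thesis
    using pos xt_yt_nonzero by (subst rat_map_value_iff[OF refl]) auto
next
  case True
  have "\<not> rat_map_value (Fract (xt ^ m) (yt ^ n)) (\<sigma> (0, 0)) q"
  proof
    assume "rat_map_value (Fract (xt ^ m) (yt ^ n)) (\<sigma> (0, 0)) q"
    then obtain F G where FG: "G \<noteq> 0" "Fract (xt ^ m) (yt ^ n) = Fract F G"
      "(bieval F (\<sigma> (0, 0)), bieval G (\<sigma> (0, 0))) \<noteq> (0, 0)"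
      unfolding rat_map_value_def by blast
    then have "xt ^ m * G = F * yt ^ n"
      using xt_yt_nonzero by (simp add: eq_fract)
    from this[THEN arg_cong, of "\<lambda>H. bieval H (\<sigma> (u, v))" for u v]
    have cross: "u ^ m * bieval G (\<sigma> (u, v)) = bieval F (\<sigma> (u, v)) * v ^ n" for u v
      by simp
    have F0: "bieval F (\<sigma> (0, v)) = 0" if "v \<noteq> 0" for v
      using cross[of 0 v] pos that by (simp add: zero_power)
    have G0: "bieval G (\<sigma> (u, 0)) = 0" if "u \<noteq> 0" for u
      using cross[of u 0] pos that by (simp add: zero_power)
    have "\<sigma> (poly 0 0, poly [:0, 1:] 0) \<in> {p. bieval F p = 0}"
      by (rule chart_punctured_curve[OF zclosed_zero_set])
        (simp add: F0)
    moreover have "\<sigma> (poly [:0, 1:] 0, poly 0 0) \<in> {p. bieval G p = 0}"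
      by (rule chart_punctured_curve[OF zclosed_zero_set])
        (simp add: G0)
    ultimately show False using FG(3) by simp
  qed
  then show ?thesis using True by simp
qed

lemma equivariant_same_sign:
  assumes h: "\<And>v. h v = 0" and pos: "m > 0" "n > 0"
  shows "equivariant_map \<phi> (Fract (xt ^ m) (yt ^ n))"
proof -
  have "a ^ m \<noteq> 0" "b ^ n \<noteq> 0" using nonzero by simp_all
  from diagonal_aut_proj_line[OF this] obtain \<psi> where \<psi>: "\<psi> \<in> aut_proj_line"
    "\<And>u v. \<psi> (proj_point (u, v)) = proj_point (a ^ m * u, b ^ n * v)"
    by blast
  have "q' = \<psi> q"
    if "rat_map_value (Fract (xt ^ m) (yt ^ n)) p q" "rat_map_value (Fract (xt ^ m) (yt ^ n)) (\<phi> p) q'"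
    for p q q'
  proof -
    obtain u v where p: "p = \<sigma> (u, v)" by (rule chart_cases)
    show ?thesis
      using that h by (simp add: p \<phi>_\<sigma> value_same_sign[OF pos] \<psi>(2) power_mult_distrib)
  qed
  then show ?thesis unfolding equivariant_map_def using \<psi>(1) by blast
qed

text \<open>
  The curve \<open>t \<mapsto> (u * t ^ n, v * t ^ m)\<close> stays in one fiber for \<open>t \<noteq> 0\<close> and reaches the origin at
  \<open>t = 0\<close>; this is where positivity of both exponents enters.
\<close>

lemma fiber_through_origin:
  assumes pos: "m > 0" "n > 0" and uv: "(u, v) \<noteq> (0, 0)"
  shows "\<sigma> (0, 0) \<in> fiber (Fract (xt ^ m) (yt ^ n)) (proj_point (u ^ m, v ^ n))"
  unfolding fiber_def zclosure_def
proof (rule InterI, clarify)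
  fix Z assume Z: "zclosed Z"
    "{p. rat_map_value (Fract (xt ^ m) (yt ^ n)) p (proj_point (u ^ m, v ^ n))} \<subseteq> Z"
  have "\<sigma> (poly (monom u n) 0, poly (monom v m) 0) \<in> Z"
  proof (rule chart_punctured_curve[OF Z(1)])
    fix t :: 'a assume t: "t \<noteq> 0"
    have eq: "proj_point (u ^ m, v ^ n) = proj_point ((u * t ^ n) ^ m, (v * t ^ m) ^ n)"
      using uv t pos
      by (subst proj_point_eq_iff) (auto simp: power_mult_distrib mult_ac simp flip: power_mult)
    have "\<sigma> (u * t ^ n, v * t ^ m) \<in> Z"
      using Z(2) uv t unfolding eq by (auto simp: value_same_sign[OF pos])
    then show "\<sigma> (poly (monom u n) t, poly (monom v m) t) \<in> Z"
      by (simp add: poly_monom)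
  qed
  then show "\<sigma> (0, 0) \<in> Z" using pos by (simp add: poly_monom zero_power)
qed

text \<open>
  The torus contains the group \<open>\<xi> ^ m = \<eta> ^ n\<close>, which acts transitively on each fiber with the origin
  removed. So Y contains every fiber through its points other than the origin, and the
  origin lies on each of these fibers. The point \<open>(u0, v0)\<close> guarantees that there is at least one.
\<close>

lemma union_of_fibers_same_sign:
  assumes pos: "m > 0" "n > 0"
    and torus: "\<And>\<xi> \<eta>. \<xi> \<noteq> 0 \<Longrightarrow> \<eta> \<noteq> 0 \<Longrightarrow> \<xi> ^ m = \<eta> ^ n \<Longrightarrow> (\<xi>, \<eta>) \<in> torus"
    and Y: "Y \<in> invariant_lattice \<phi>" "\<sigma> (u0, v0) \<in> Y" "(u0, v0) \<noteq> (0, 0)"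
  shows "union_of_fibers (Fract (xt ^ m) (yt ^ n)) Y"
proof -
  let ?f = "Fract (xt ^ m) (yt ^ n)"
  have transitive: "\<sigma> (u', v') \<in> Y"
    if mem: "\<sigma> (u, v) \<in> Y" and uv: "(u, v) \<noteq> (0, 0)" and uv': "(u', v') \<noteq> (0, 0)"
      and cross: "u ^ m * v' ^ n = u' ^ m * v ^ n"
    for u v u' v'
  proof -
    \<comment> \<open>On an axis one of the two scaling factors has to be chosen as a root.\<close>
    obtain \<xi> \<eta> where "\<xi> \<noteq> 0" "\<eta> \<noteq> 0" "\<xi> ^ m = \<eta> ^ n" "u' = \<xi> * u" "v' = \<eta> * v"
    proof (cases "u = 0 \<or> v = 0")
      case False
      then have "u' \<noteq> 0" "v' \<noteq> 0" using cross uv' pos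
        by (auto simp: zero_power)
      then show ?thesis
        using cross False by (intro that[of "u' / u" "v' / v"]) (auto simp: field_simps)
    next
      case True
      then consider "u = 0" "v \<noteq> 0" "u' = 0" "v' \<noteq> 0" | "v = 0" "u \<noteq> 0" "v' = 0" "u' \<noteq> 0"
        using cross uv uv' pos
        by (auto simp: zero_power)
      then show ?thesis
      proof cases
        case 1
        obtain \<xi> where "\<xi> ^ m = (v' / v) ^ n" using nth_root_exists[OF pos(1)] by blast
        then show ?thesis using 1 pos by (intro that[of \<xi> "v' / v"]) (auto simp: zero_power)
      next
        case 2
        obtain \<eta> where "\<eta> ^ n = (u' / u) ^ m" using nth_root_exists[OF pos(2)] by blast
        then show ?thesis using 2 pos by (intro that[of "u' / u" \<eta>]) (auto simp: zero_power)
      qed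
    qed
    then show ?thesis using lattice_torus[OF Y(1) mem torus] by simp
  qed
  define Q where "Q = {proj_point (u ^ m, v ^ n) | u v. \<sigma> (u, v) \<in> Y \<and> (u, v) \<noteq> (0, 0)}"
  have "Q \<subseteq> proj_line"
    using pos by (auto simp: Q_def intro!: proj_point_in_proj_line)
  moreover have "\<Union>(fiber ?f ` Q) = Y"
  proof
    show "\<Union>(fiber ?f ` Q) \<subseteq> Y"
    proof (rule UN_least)
      fix q assume "q \<in> Q"
      then obtain u v where q: "q = proj_point (u ^ m, v ^ n)" "\<sigma> (u, v) \<in> Y" "(u, v) \<noteq> (0, 0)"
        by (auto simp: Q_def)
      have "p \<in> Y" if val: "rat_map_value ?f p q" for p
      proof -
        obtain u' v' where p: "p = \<sigma> (u', v')" by (rule chart_cases)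
        have "(u', v') \<noteq> (0, 0)" "proj_point (u ^ m, v ^ n) = proj_point (u' ^ m, v' ^ n)"
          using val by (auto simp: p value_same_sign[OF pos] q(1))
        moreover from this have "u ^ m * v' ^ n = u' ^ m * v ^ n"
          using q(3) pos by (subst (asm) proj_point_eq_iff) auto
        ultimately show ?thesis using transitive[OF q(2,3)] p by blast
      qed
      then show "fiber ?f q \<subseteq> Y"
        using Y(1) by (intro fiber_subsetI) (simp_all add: lattice_iff)
    qed
    show "Y \<subseteq> \<Union>(fiber ?f ` Q)"
    proof
      fix p assume "p \<in> Y"
      obtain u v where p: "p = \<sigma> (u, v)" by (rule chart_cases)
      show "p \<in> \<Union>(fiber ?f ` Q)"
      proof (cases "(u, v) = (0, 0)")
        case True
        have "proj_point (u0 ^ m, v0 ^ n) \<in> Q" using Y by (auto simp: Q_def)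
        moreover have "p \<in> fiber ?f (proj_point (u0 ^ m, v0 ^ n))"
          using fiber_through_origin[OF pos Y(3)] True by (simp add: p)
        ultimately show ?thesis by blast
      next
        case False
        then have "proj_point (u ^ m, v ^ n) \<in> Q" using \<open>p \<in> Y\<close> by (auto simp: Q_def p)
        moreover from False have "rat_map_value ?f p (proj_point (u ^ m, v ^ n))"
          unfolding p value_same_sign[OF pos] by blast
        then have "p \<in> fiber ?f (proj_point (u ^ m, v ^ n))"
          by (rule mem_fiberI)
        ultimately show ?thesis by blast
      qed
    qed
  qed
  ultimately show ?thesis unfolding union_of_fibers_def by blast
qed

lemma generated_same_sign:
  assumes pos: "m > 0" "n > 0"
    and torus: "\<And>\<xi> \<eta>. \<xi> \<noteq> 0 \<Longrightarrow> \<eta> \<noteq> 0 \<Longrightarrow> \<xi> ^ m = \<eta> ^ n \<Longrightarrow> (\<xi>, \<eta>) \<in> torus"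
  shows "\<exists>\<U>. (\<forall>U\<in>\<U>. union_of_fibers (Fract (xt ^ m) (yt ^ n)) U) \<and>
    generates_lattice (\<U> \<union> {vanishing {xt, yt}}) \<phi>"
proof (intro exI conjI ballI)
  let ?U = "{U \<in> invariant_lattice \<phi>. union_of_fibers (Fract (xt ^ m) (yt ^ n)) U}"
  show "union_of_fibers (Fract (xt ^ m) (yt ^ n)) U" if "U \<in> ?U" for U
    using that by simp
  show "generates_lattice (?U \<union> {vanishing {xt, yt}}) \<phi>"
  proof (rule generates_latticeI)
    fix Y p assume Y: "Y \<in> invariant_lattice \<phi>" "p \<in> Y"
    obtain u v where p: "p = \<sigma> (u, v)" by (rule chart_cases)
    show "\<exists>W\<in>?U \<union> {vanishing {xt, yt}}. p \<in> W \<and> W \<subseteq> Y"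
    proof (cases "(u, v) = (0, 0)")
      case True
      then show ?thesis using Y(2) by (auto simp: p origin_eq)
    next
      case False
      then have "Y \<in> ?U"
        using union_of_fibers_same_sign[OF pos torus Y(1) _ False] Y p by blast
      then show ?thesis using Y(2) by blast
    qed
  qed (use origin_in_lattice in auto)
qed

lemma value_opposite_sign:
  "rat_map_value (Fract (xt ^ m * yt ^ n) 1) (\<sigma> (u, v)) q \<longleftrightarrow> q = proj_point (u ^ m * v ^ n, 1)"
  by (subst rat_map_value_iff[OF refl]) auto

lemma equivariant_opposite_sign:
  assumes h: "\<And>v. h v = 0"
  shows "equivariant_map \<phi> (Fract (xt ^ m * yt ^ n) 1)"
proof -
  have "a ^ m * b ^ n \<noteq> 0" "(1 :: 'a) \<noteq> 0" using nonzero by simp_all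
  from diagonal_aut_proj_line[OF this] obtain \<psi> where \<psi>: "\<psi> \<in> aut_proj_line"
    "\<And>u v. \<psi> (proj_point (u, v)) = proj_point (a ^ m * b ^ n * u, 1 * v)"
    by blast
  have "q' = \<psi> q"
    if "rat_map_value (Fract (xt ^ m * yt ^ n) 1) p q" "rat_map_value (Fract (xt ^ m * yt ^ n) 1) (\<phi> p) q'"
    for p q q'
  proof -
    obtain u v where p: "p = \<sigma> (u, v)" by (rule chart_cases)
    show ?thesis
      using that h by (simp add: p \<phi>_\<sigma> value_opposite_sign \<psi>(2) power_mult_distrib mult_ac)
  qed
  then show ?thesis unfolding equivariant_map_def using \<psi>(1) by blast
qed

text \<open>
  For exponents of opposite sign the map is the polynomial \<open>xt ^ m * yt ^ n\<close>, and the fibers off the axes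
  are closed orbits of the group \<open>\<xi> ^ m * \<eta> ^ n = 1\<close>. The part U of Y off the axes is a union of such
  fibers. Infinitely many of them would meet each line \<open>u = const \<noteq> 0\<close> in infinitely many points, so
  that Y would contain these lines and be the whole plane. Hence only a finite set Q of values
  occurs, and U is closed.
\<close>

lemma off_axes_union_of_fibers:
  assumes pos: "m > 0" "n > 0" and h: "\<And>v. h v = 0"
    and torus: "\<And>\<xi> \<eta>. \<xi> \<noteq> 0 \<Longrightarrow> \<eta> \<noteq> 0 \<Longrightarrow> \<xi> ^ m * \<eta> ^ n = 1 \<Longrightarrow> (\<xi>, \<eta>) \<in> torus"
    and Y: "Y \<in> invariant_lattice \<phi>" "Y \<noteq> UNIV"
  defines "U \<equiv> {p \<in> Y. bieval xt p \<noteq> 0 \<and> bieval yt p \<noteq> 0}"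
  shows "U \<in> invariant_lattice \<phi>" and "union_of_fibers (Fract (xt ^ m * yt ^ n) 1) U"
proof -
  let ?f = "Fract (xt ^ m * yt ^ n) 1"
  have zclosed_Y: "zclosed Y" using Y(1) by (simp add: lattice_iff)
  have transitive: "\<sigma> (u', v') \<in> Y"
    if "\<sigma> (u, v) \<in> Y" "u \<noteq> 0" "v \<noteq> 0" "u' ^ m * v' ^ n = u ^ m * v ^ n" for u v u' v'
  proof -
    have "u' \<noteq> 0" "v' \<noteq> 0" using that pos by (auto simp: zero_power)
    moreover have "(u' / u) ^ m * (v' / v) ^ n = 1"
      using that by (simp add: field_simps)
    ultimately show ?thesis
      using lattice_torus[OF Y(1) that(1) torus, of "u' / u" "v' / v"] that(2,3) by simp
  qed
  define Q where "Q = {u ^ m * v ^ n | u v. u \<noteq> 0 \<and> v \<noteq> 0 \<and> \<sigma> (u, v) \<in> Y}"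
  have "0 \<notin> Q" by (auto simp: Q_def)
  have mem_U: "\<sigma> (u, v) \<in> U \<longleftrightarrow> u ^ m * v ^ n \<in> Q" for u v
  proof
    assume "u ^ m * v ^ n \<in> Q"
    then obtain u' v' where *: "u ^ m * v ^ n = u' ^ m * v' ^ n" "u' \<noteq> 0" "v' \<noteq> 0" "\<sigma> (u', v') \<in> Y"
      by (auto simp: Q_def)
    then have "u \<noteq> 0 \<and> v \<noteq> 0" using pos by (auto simp: zero_power)
    then show "\<sigma> (u, v) \<in> U" using transitive[OF *(4,2,3,1)] by (simp add: U_def)
  qed (auto simp: U_def Q_def)
  have "finite Q"
  proof (rule ccontr)
    assume inf: "infinite Q"
    have "\<sigma> (u, v) \<in> Y" if "u \<noteq> 0" for u v
    proof -
      have "Q \<subseteq> (\<lambda>w. u ^ m * w ^ n) ` {w. \<sigma> (u, w) \<in> Y}"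
      proof
        fix t assume "t \<in> Q"
        then obtain u' v' where *: "t = u' ^ m * v' ^ n" "u' \<noteq> 0" "v' \<noteq> 0" "\<sigma> (u', v') \<in> Y"
          by (auto simp: Q_def)
        obtain w where w: "w ^ n = t / u ^ m" using nth_root_exists[OF pos(2)] by blast
        then have eq: "u ^ m * w ^ n = t" using \<open>u \<noteq> 0\<close> by simp
        then have "\<sigma> (u, w) \<in> Y" using transitive[OF *(4,2,3)] *(1) by simp
        then show "t \<in> (\<lambda>w. u ^ m * w ^ n) ` {w. \<sigma> (u, w) \<in> Y}" using eq by blast
      qed
      then have "infinite {w. \<sigma> (u, w) \<in> Y}"
        using inf finite_subset by blast
      then show ?thesis
        using zclosed_contains_curve[OF zclosed_chart[OF zclosed_Y], of "[:u:]" "[:0, 1:]" v] by simp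
    qed
    then show False using chart_dense[OF zclosed_Y] Y(2) by blast
  qed
  have "U = {p. bieval (\<Prod>t\<in>Q. xt ^ m * yt ^ n - [:[:t:]:]) p = 0}"
  proof -
    have "p \<in> U \<longleftrightarrow> bieval (\<Prod>t\<in>Q. xt ^ m * yt ^ n - [:[:t:]:]) p = 0" for p
      by (rule chart_cases[of p]) (use \<open>finite Q\<close> in \<open>auto simp: mem_U\<close>)
    then show ?thesis by blast
  qed
  then have zclosed_U: "zclosed U" by (metis zclosed_zero_set)
  show "U \<in> invariant_lattice \<phi>"
    using Y(1) zclosed_U nonzero h by (simp add: lattice_iff U_def)
  define Q' where "Q' = (\<lambda>t. proj_point (t, 1)) ` Q"
  have "Q' \<subseteq> proj_line"
    by (auto simp: Q'_def intro!: proj_point_in_proj_line)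
  moreover have "U = \<Union>(fiber ?f ` Q')"
  proof
    show "U \<subseteq> \<Union>(fiber ?f ` Q')"
    proof
      fix p assume "p \<in> U"
      obtain u v where p: "p = \<sigma> (u, v)" by (rule chart_cases)
      have "rat_map_value ?f p (proj_point (u ^ m * v ^ n, 1))"
        by (simp add: p value_opposite_sign)
      then have "p \<in> fiber ?f (proj_point (u ^ m * v ^ n, 1))"
        by (rule mem_fiberI)
      moreover have "u ^ m * v ^ n \<in> Q" using \<open>p \<in> U\<close> by (simp add: p mem_U)
      ultimately show "p \<in> \<Union>(fiber ?f ` Q')" by (auto simp: Q'_def)
    qed
    show "\<Union>(fiber ?f ` Q') \<subseteq> U"
    proof (rule UN_least)
      fix q assume "q \<in> Q'"
      then obtain t where t: "t \<in> Q" "q = proj_point (t, 1)" by (auto simp: Q'_def)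
      have "p \<in> U" if val: "rat_map_value ?f p q" for p
      proof -
        obtain u v where p: "p = \<sigma> (u, v)" by (rule chart_cases)
        have "proj_point (t, 1) = proj_point (u ^ m * v ^ n, 1)"
          using val by (simp add: p value_opposite_sign t(2))
        then have "t = u ^ m * v ^ n" by (subst (asm) proj_point_eq_iff) auto
        then show ?thesis using t(1) by (simp add: p mem_U)
      qed
      then show "fiber ?f q \<subseteq> U"
        by (intro fiber_subsetI zclosed_U)
    qed
  qed
  ultimately show "union_of_fibers ?f U" unfolding union_of_fibers_def by blast
qed

text \<open>
  The axes have to be listed, since together they form a single fiber; the torus is
  transitive on each punctured axis, because for every \<open>\<xi>\<close> there is an \<open>\<eta>\<close> with \<open>\<xi> ^ m * \<eta> ^ n = 1\<close> and
  conversely.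
\<close>

lemma generated_opposite_sign:
  assumes pos: "m > 0" "n > 0" and h: "\<And>v. h v = 0"
    and torus: "\<And>\<xi> \<eta>. \<xi> \<noteq> 0 \<Longrightarrow> \<eta> \<noteq> 0 \<Longrightarrow> \<xi> ^ m * \<eta> ^ n = 1 \<Longrightarrow> (\<xi>, \<eta>) \<in> torus"
  shows "\<exists>\<U>. (\<forall>U\<in>\<U>. union_of_fibers (Fract (xt ^ m * yt ^ n) 1) U) \<and>
    generates_lattice (\<U> \<union> {vanishing {xt}, vanishing {yt}, vanishing {xt, yt}}) \<phi>"
proof (intro exI conjI ballI)
  let ?U = "{U \<in> invariant_lattice \<phi>. union_of_fibers (Fract (xt ^ m * yt ^ n) 1) U}"
  let ?I = "?U \<union> {vanishing {xt}, vanishing {yt}, vanishing {xt, yt}}"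
  show "union_of_fibers (Fract (xt ^ m * yt ^ n) 1) U" if "U \<in> ?U" for U
    using that by simp
  have \<xi>: "\<exists>\<eta>. (\<xi>, \<eta>) \<in> torus" if "\<xi> \<noteq> 0" for \<xi>
  proof -
    obtain \<eta> where "\<eta> ^ n = inverse (\<xi> ^ m)" using nth_root_exists[OF pos(2)] by blast
    moreover from this have "\<eta> \<noteq> 0" using that pos by (auto simp: zero_power)
    ultimately show ?thesis using torus[of \<xi> \<eta>] that by auto
  qed
  have \<eta>: "\<exists>\<xi>. (\<xi>, \<eta>) \<in> torus" if "\<eta> \<noteq> 0" for \<eta>
  proof -
    obtain \<xi> where "\<xi> ^ m = inverse (\<eta> ^ n)" using nth_root_exists[OF pos(1)] by blast
    moreover from this have "\<xi> \<noteq> 0" using that pos by (auto simp: zero_power)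
    ultimately show ?thesis using torus[of \<xi> \<eta>] that by auto
  qed
  show "generates_lattice ?I \<phi>"
  proof (rule generates_latticeI)
    fix Y p assume Y: "Y \<in> invariant_lattice \<phi>" "Y \<noteq> UNIV" "p \<in> Y"
    obtain u v where p: "p = \<sigma> (u, v)" by (rule chart_cases)
    consider "u = 0" "v = 0" | "u = 0" "v \<noteq> 0" | "u \<noteq> 0" "v = 0" | "u \<noteq> 0" "v \<noteq> 0" by blast
    then show "\<exists>W\<in>?I. p \<in> W \<and> W \<subseteq> Y"
    proof cases
      case 1
      then show ?thesis using Y(3) by (auto simp: p origin_eq)
    next
      case 2
      then have "vanishing {xt} \<subseteq> Y"
        using x_zero_subset[OF Y(1) _ 2(2) \<eta>] Y(3) unfolding p by blast
      then show ?thesis using 2 by (auto simp: p)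
    next
      case 3
      then have "vanishing {yt} \<subseteq> Y"
        using y_zero_subset[OF Y(1) _ 3(1) \<xi>] Y(3) unfolding p by blast
      then show ?thesis using 3 by (auto simp: p)
    next
      case 4
      let ?W = "{p \<in> Y. bieval xt p \<noteq> 0 \<and> bieval yt p \<noteq> 0}"
      have "?W \<in> invariant_lattice \<phi>"
        by (rule off_axes_union_of_fibers(1)[OF pos h _ Y(1,2)]) (rule torus)
      moreover have "union_of_fibers (Fract (xt ^ m * yt ^ n) 1) ?W"
        by (rule off_axes_union_of_fibers(2)[OF pos h _ Y(1,2)]) (rule torus)
      ultimately have "?W \<in> ?I" by simp
      moreover have "p \<in> ?W" using 4 Y(3) by (simp add: p)
      moreover have "?W \<subseteq> Y" by simp
      ultimately show ?thesis by (intro bexI[of _ ?W]) simp_all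
    qed
  qed (use origin_in_lattice y_zero_in_lattice x_zero_in_lattice[OF h] in auto)
qed

end


section \<open>Exponents of arbitrary sign\<close>

lemma least_relation_uminus:
  assumes "least_relation a b r1 r2"
  shows "least_relation a b (- r1) (- r2)"
proof -
  have "range (\<lambda>k::int. (k * - r1, k * - r2)) = range ((\<lambda>k. (k * r1, k * r2)) \<circ> uminus)"
    by (simp add: comp_def)
  also have "\<dots> = range (\<lambda>k. (k * r1, k * r2))"
    by (simp only: image_comp[symmetric] surj_uminus)
  finally show ?thesis using assms by (simp only: least_relation_def)
qed

context normalized_jonq
begin

text \<open>
  The generator \<open>(d * s1, d * s2)\<close> enters in two ways: the group \<open>\<xi> powi s1 = \<eta> powi s2\<close> lies in the
  torus, which determines the fibration, whereas invariant equations need the relation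
  \<open>a powi (d * s1) = b powi (d * s2)\<close> itself, as \<open>a powi s1\<close> and \<open>b powi s2\<close> may differ by a
  root of unity.
\<close>

lemma resonant_pos:
  assumes h: "\<And>v. h v = 0" and least: "least_relation a b (d * s1) (d * s2)"
    and pos: "d > 0" "s1 > 0" and s2: "s2 \<noteq> 0"
  shows "equivariant_map \<phi> (monomial_map xt yt s1 s2)" (is ?equivariant)
    and "lattice_support \<phi> = UNIV" (is ?support)
    and "s1 * s2 > 0 \<Longrightarrow> \<exists>\<U>. (\<forall>U\<in>\<U>. union_of_fibers (monomial_map xt yt s1 s2) U) \<and>
      generates_lattice (\<U> \<union> {vanishing {xt, yt}}) \<phi>" (is "_ \<Longrightarrow> ?same")
    and "s1 * s2 < 0 \<Longrightarrow> \<exists>\<U>. (\<forall>U\<in>\<U>. union_of_fibers (monomial_map xt yt s1 s2) U) \<and>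
      generates_lattice (\<U> \<union> {vanishing {xt}, vanishing {yt}, vanishing {xt, yt}}) \<phi>"
      (is "_ \<Longrightarrow> ?opposite")
proof -
  obtain m where m: "s1 = int m" "m > 0" using pos(2) by (metis pos_int_cases)
  obtain e where e: "d = int e" "e > 0" using pos(1) by (metis pos_int_cases)
  have "(1 * (d * s1), 1 * (d * s2)) \<in> {(m1, m2). a powi m1 = b powi m2}"
    using least unfolding least_relation_def by blast
  then have rel: "a powi (int (e * m)) = b powi (int e * s2)" by (simp add: m e)
  have "?equivariant \<and> ?support \<and> (s1 * s2 > 0 \<longrightarrow> ?same) \<and> (s1 * s2 < 0 \<longrightarrow> ?opposite)"
  proof (cases "s2 > 0")
    case True
    then obtain n where n: "s2 = int n" "n > 0" by (metis pos_int_cases)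
    have map: "monomial_map xt yt s1 s2 = Fract (xt ^ m) (yt ^ n)"
      using xt_yt_nonzero by (simp add: m n monomial_map_same_sign)
    have "a powi (int (e * m)) = b powi (int (e * n))" using rel by (simp add: n)
    then have "a ^ (e * m) = b ^ (e * n)" by (simp only: power_int_of_nat)
    then have support: ?support
      using support_same_sign[OF h, of "e * m" "e * n"] m n e by simp
    have torus: "(\<xi>, \<eta>) \<in> torus" if "\<xi> \<noteq> 0" "\<eta> \<noteq> 0" "\<xi> ^ m = \<eta> ^ n" for \<xi> \<eta>
      using that by (intro torus_least_relation[OF least]) (simp_all add: m n)
    have ?same
      unfolding map by (rule generated_same_sign[OF m(2) n(2)]) (rule torus)
    moreover have ?equivariant
      unfolding map by (rule equivariant_same_sign[OF h m(2) n(2)])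
    moreover have "\<not> s1 * s2 < 0" using m n by (simp add: not_less)
    ultimately show ?thesis using support by blast
  next
    case False
    then obtain n where n: "s2 = - int n" "n > 0"
      using s2 by (metis minus_minus neg_0_less_iff_less not_less_iff_gr_or_eq pos_int_cases)
    have map: "monomial_map xt yt s1 s2 = Fract (xt ^ m * yt ^ n) 1"
      by (simp add: m n monomial_map_opposite_sign)
    have "a powi (int (e * m)) = b powi (- int (e * n))" using rel by (simp add: n)
    then have "a ^ (e * m) * b ^ (e * n) = 1"
      using nonzero by (simp only: power_int_minus power_int_of_nat) simp
    then have support: ?support
      using support_opposite_sign[OF h, of "e * m" "e * n"] m n e by simp
    have torus: "(\<xi>, \<eta>) \<in> torus" if "\<xi> \<noteq> 0" "\<eta> \<noteq> 0" "\<xi> ^ m * \<eta> ^ n = 1" for \<xi> \<eta>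
      using that by (intro torus_least_relation[OF least])
        (simp_all add: m n power_int_minus field_simps)
    have ?opposite
      unfolding map by (rule generated_opposite_sign[OF m(2) n(2) h]) (rule torus)
    moreover have ?equivariant
      unfolding map by (rule equivariant_opposite_sign[OF h])
    moreover have "\<not> s1 * s2 > 0" using m n by (simp add: not_less)
    ultimately show ?thesis using support by blast
  qed
  then show ?equivariant ?support "s1 * s2 > 0 \<Longrightarrow> ?same" "s1 * s2 < 0 \<Longrightarrow> ?opposite"
    by blast+
qed

lemma resonant:
  assumes h: "\<And>v. h v = 0" and least: "least_relation a b (d * s1) (d * s2)"
    and d: "d > 0" and s: "s1 \<noteq> 0" "s2 \<noteq> 0"
  shows "equivariant_map \<phi> (monomial_map xt yt s1 s2)"
    and "lattice_support \<phi> = UNIV"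
    and "s1 * s2 > 0 \<Longrightarrow> \<exists>\<U>. (\<forall>U\<in>\<U>. union_of_fibers (monomial_map xt yt s1 s2) U) \<and>
      generates_lattice (\<U> \<union> {vanishing {xt, yt}}) \<phi>"
    and "s1 * s2 < 0 \<Longrightarrow> \<exists>\<U>. (\<forall>U\<in>\<U>. union_of_fibers (monomial_map xt yt s1 s2) U) \<and>
      generates_lattice (\<U> \<union> {vanishing {xt}, vanishing {yt}, vanishing {xt, yt}}) \<phi>"
proof -
  define t1 t2 where "t1 = (if s1 > 0 then s1 else - s1)" and "t2 = (if s1 > 0 then s2 else - s2)"
  have t: "t1 > 0" "t2 \<noteq> 0" "t1 * t2 = s1 * s2" using s by (auto simp: t1_def t2_def)
  have least_t: "least_relation a b (d * t1) (d * t2)"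
    using least least_relation_uminus[OF least] by (simp add: t1_def t2_def)
  define f where "f = monomial_map xt yt s1 s2"
  define g where "g = monomial_map xt yt t1 t2"
  have "g \<noteq> 0" using xt_yt_nonzero by (simp add: g_def monomial_map_def)
  have f: "f = g \<or> f = inverse g"
    by (simp add: f_def g_def t1_def t2_def monomial_map_uminus)
  have fibers: "union_of_fibers f U" if "union_of_fibers g U" for U
    using f that union_of_fibers_inverse[OF \<open>g \<noteq> 0\<close>] by metis
  note res = resonant_pos[OF h least_t d t(1,2), folded g_def, unfolded t(3)]
  show "equivariant_map \<phi> (monomial_map xt yt s1 s2)"
    using f res(1) equivariant_map_inverse[OF \<open>g \<noteq> 0\<close>] by (metis f_def)
  show "lattice_support \<phi> = UNIV" by (rule res(2))
  show "\<exists>\<U>. (\<forall>U\<in>\<U>. union_of_fibers (monomial_map xt yt s1 s2) U) \<and>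
      generates_lattice (\<U> \<union> {vanishing {xt, yt}}) \<phi>" if "s1 * s2 > 0"
    using res(3)[OF that] fibers unfolding f_def by blast
  show "\<exists>\<U>. (\<forall>U\<in>\<U>. union_of_fibers (monomial_map xt yt s1 s2) U) \<and>
      generates_lattice (\<U> \<union> {vanishing {xt}, vanishing {yt}, vanishing {xt, yt}}) \<phi>"
    if "s1 * s2 < 0"
    using res(4)[OF that] fibers unfolding f_def by blast
qed

end


section \<open>The normal form of a de Jonquieres automorphism\<close>

text \<open>
  The polynomial q subtracted from x in \<open>xtilde\<close> solves
  \<open>a * q y + P y = h1 y + q (b * y + c)\<close>: comparing coefficients of \<open>ytil ^ i\<close>, this
  removes every term of P with \<open>a \<noteq> b ^ i\<close> and leaves exactly \<open>h1\<close>. Since e is the fixed point of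
  \<open>y \<mapsto> b * y + c\<close>, the second coordinate becomes linear.
\<close>

lemma normalized_jonqI:
  fixes a b c :: "'a::{alg_closed_field, field_char_0}" and P :: "'a poly"
  assumes ab: "a \<noteq> 0" "b \<noteq> 0" and deg: "degree P \<le> n"
    and roots: "\<not> (\<exists>m>0. a ^ m = 1)" "\<not> (\<exists>m>0. b ^ m = 1)"
  shows "\<exists>\<sigma> A B. normalized_jonq a b (\<lambda>v. poly (h1 n a b c P) (v + c / (1 - b)))
    (jonq a b c P) \<sigma> (xtilde n a b c P) (ytilde b c) A B"
proof -
  define e where "e = c / (1 - b)"
  define t where "t = atil b c P"
  define q where "q = (\<Sum>i | i \<le> n \<and> a \<noteq> b ^ i. smult (t i / (b ^ i - a)) (ytil b c ^ i))"
  define \<sigma> where "\<sigma> = (\<lambda>(u, v). (u + poly q (v + e), v + e))"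
  have "b \<noteq> 1" using roots(2) by (metis power_one_right zero_less_one)
  then have e: "b * e + c = e" by (simp add: e_def field_simps)
  have q: "poly q (v + e) = (\<Sum>i | i \<le> n \<and> a \<noteq> b ^ i. t i / (b ^ i - a) * v ^ i)" for v
    by (simp add: q_def ytil_def poly_sum poly_power e_def)
  have h: "poly (h1 n a b c P) (v + e) = (\<Sum>i | i \<le> n \<and> a = b ^ i. t i * v ^ i)" for v
    by (simp add: h1_def ytil_def poly_sum poly_power e_def t_def)
  have P: "poly P (v + e) = (\<Sum>i\<le>n. t i * v ^ i)" for v
    by (subst expansion_ytil[OF deg, of b c]) (simp add: ytil_def poly_sum poly_power e_def t_def)
  have xt: "bieval (xtilde n a b c P) (x, y) = x - poly q y" for x y
    unfolding xtilde_def q_def t_def by simp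
  have yt: "bieval (ytilde b c) (x, y) = y - e" for x y
    by (simp add: ytilde_def ytil_def e_def)
  have conj: "a * poly q (v + e) + poly P (v + e) = poly (h1 n a b c P) (v + e) + poly q (b * v + e)" for v
  proof -
    have split: "(\<Sum>i\<le>n. f i) = (\<Sum>i | i \<le> n \<and> a = b ^ i. f i) + (\<Sum>i | i \<le> n \<and> a \<noteq> b ^ i. f i)"
      for f :: "nat \<Rightarrow> 'a"
      by (subst sum.union_disjoint[symmetric]) (auto intro!: sum.cong)
    have "a * poly q (v + e) + (\<Sum>i | i \<le> n \<and> a \<noteq> b ^ i. t i * v ^ i) = poly q (b * v + e)"
      unfolding q sum_distrib_left sum.distrib[symmetric]
      by (intro sum.cong refl) (auto simp: field_simps power_mult_distrib)
    then show ?thesis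
      unfolding P h split by (simp add: algebra_simps)
  qed
  have "normalized_jonq a b (\<lambda>v. poly (h1 n a b c P) (v + e)) (jonq a b c P) \<sigma>
      (xtilde n a b c P) (ytilde b c) [:pcompose q [:e, 1:], 1:] [:[:e, 1:]:]"
  proof
    show "poly (h1 n a b c P) (b * v + e) = a * poly (h1 n a b c P) (v + e)" for v
      unfolding h sum_distrib_left by (intro sum.cong refl) (auto simp: power_mult_distrib)
    show "\<sigma> p = (bieval [:pcompose q [:e, 1:], 1:] p, bieval [:[:e, 1:]:] p)" for p
      by (cases p) (simp add: \<sigma>_def poly_pcompose add.commute)
    show "\<sigma> (bieval (xtilde n a b c P) p, bieval (ytilde b c) p) = p" for p
      by (cases p) (simp add: \<sigma>_def xt yt)
    show "jonq a b c P (\<sigma> (u, v)) = \<sigma> (a * u + poly (h1 n a b c P) (v + e), b * v)" for u v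
    proof -
      have "b * (v + e) + c = b * v + e" using e by (simp add: algebra_simps)
      moreover have "a * (u + poly q (v + e)) + poly P (v + e)
          = a * u + poly (h1 n a b c P) (v + e) + poly q (b * v + e)"
        using conj[of v] by (simp add: algebra_simps)
      ultimately show ?thesis by (simp add: jonq_def \<sigma>_def)
    qed
    show "a ^ m \<noteq> 1" "b ^ m \<noteq> 1" if "m > 0" for m
      using roots that by blast+
  qed (use ab in \<open>simp_all add: \<sigma>_def xt yt\<close>)
  then show ?thesis unfolding e_def by blast
qed

text \<open>
  As b is not a root of unity, at most one exponent i satisfies \<open>a = b ^ i\<close>, so \<open>h1\<close> is a monomial in
  \<open>ytil\<close> and vanishes only at its zero.
\<close>

lemma h1_monomial:
  fixes a b c :: "'a::field"
  assumes "h1 n a b c P \<noteq> 0" and b: "b \<noteq> 0" "\<not> (\<exists>m>0. b ^ m = 1)"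
  obtains i where "a = b ^ i" "\<And>v. v \<noteq> 0 \<Longrightarrow> poly (h1 n a b c P) (v + c / (1 - b)) \<noteq> 0"
proof -
  obtain i where i: "i \<le> n" "a = b ^ i" "atil b c P i \<noteq> 0"
    using assms(1) by (force simp: h1_def intro: sum.neutral)
  have "j = i" if eq: "b ^ j = b ^ i" for j
  proof (rule ccontr)
    have *: "b ^ (k - l) = 1" if "b ^ k = b ^ l" "l < k" for k l
      using that b(1) by (simp add: power_diff)
    assume "j \<noteq> i"
    then show False
      using *[of j i] *[of i j] eq b(2) by (metis linorder_neqE_nat zero_less_diff)
  qed
  then have "{j. j \<le> n \<and> a = b ^ j} = {i}" using i(1,2) by auto
  then have "h1 n a b c P = smult (atil b c P i) (ytil b c ^ i)" by (simp add: h1_def)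
  then show ?thesis using that[of i] i by (simp add: ytil_def poly_power)
qed


section \<open>The invariant lattice\<close>

theorem proposition5p11:
  fixes a b c :: "'a::{alg_closed_field, field_char_0}"
    and P :: "'a poly" and n :: nat
    and \<phi> :: "'a \<times> 'a \<Rightarrow> 'a \<times> 'a"
    and xt yt :: "'a poly poly"
  assumes "a \<noteq> 0" and "b \<noteq> 0" and "degree P = n"
    and \<phi>: "\<phi> = jonq a b c P"
    and a_not_root: "\<not> (\<exists>m>0. a ^ m = 1)"
    and b_not_root: "\<not> (\<exists>m>0. b ^ m = 1)"
    and xt: "xt = xtilde n a b c P"
    and yt: "yt = ytilde b c"
  shows
    "(h1 n a b c P = 0 \<and> (\<exists>m1 m2. m1 \<noteq> 0 \<and> m2 \<noteq> 0 \<and> a powi m1 = b powi m2) \<longrightarrow>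
       (\<exists>r1 r2. least_relation a b r1 r2) \<and>
       (\<forall>r1 r2 d s1 s2.
          least_relation a b r1 r2 \<and> d = gcd r1 r2 \<and> r1 = d * s1 \<and> r2 = d * s2 \<longrightarrow>
          is_unique_fixed_point \<phi> (vanishing {xt, yt}) \<and>
          equivariant_map \<phi> (monomial_map xt yt s1 s2) \<and>
          lattice_support \<phi> = UNIV \<and>
          (s1 * s2 > 0 \<longrightarrow>
             (\<exists>\<U>. (\<forall>U\<in>\<U>. union_of_fibers (monomial_map xt yt s1 s2) U) \<and>
                  generates_lattice (\<U> \<union> {vanishing {xt, yt}}) \<phi>)) \<and>
          (s1 * s2 < 0 \<longrightarrow>
             (\<exists>\<U>. (\<forall>U\<in>\<U>. union_of_fibers (monomial_map xt yt s1 s2) U) \<and>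
                  generates_lattice
                    (\<U> \<union> {vanishing {xt}, vanishing {yt}, vanishing {xt, yt}}) \<phi>))))
     \<and>
     (h1 n a b c P = 0 \<and> \<not> (\<exists>m1 m2. m1 \<noteq> 0 \<and> m2 \<noteq> 0 \<and> a powi m1 = b powi m2) \<longrightarrow>
       is_unique_fixed_point \<phi> (vanishing {xt, yt}) \<and>
       finite (invariant_lattice \<phi>) \<and>
       card {vanishing {xt}, vanishing {yt}, vanishing {xt, yt}} = 3 \<and>
       generates_lattice {vanishing {xt}, vanishing {yt}, vanishing {xt, yt}} \<phi>)
     \<and>
     (h1 n a b c P \<noteq> 0 \<longrightarrow>
       is_unique_fixed_point \<phi> (vanishing {xt, yt}) \<and>
       finite (invariant_lattice \<phi>) \<and>
       card {vanishing {yt}, vanishing {xt, yt}} = 2 \<and>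
       generates_lattice {vanishing {yt}, vanishing {xt, yt}} \<phi>)"
proof -
  obtain \<sigma> A B where normal:
    "normalized_jonq a b (\<lambda>v. poly (h1 n a b c P) (v + c / (1 - b))) \<phi> \<sigma> xt yt A B"
    using normalized_jonqI[of a b P n c] assms by blast
  interpret normalized_jonq a b "\<lambda>v. poly (h1 n a b c P) (v + c / (1 - b))" \<phi> \<sigma> xt yt A B
    by (rule normal)
  show ?thesis
  proof (intro conjI impI allI)
    show "is_unique_fixed_point \<phi> (vanishing {xt, yt})"
      "is_unique_fixed_point \<phi> (vanishing {xt, yt})"
      "is_unique_fixed_point \<phi> (vanishing {xt, yt})" by (rule unique_fixed_point)+
  next
    assume "h1 n a b c P = 0 \<and> (\<exists>m1 m2. m1 \<noteq> 0 \<and> m2 \<noteq> 0 \<and> a powi m1 = b powi m2)"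
    then obtain m1 m2 where "m1 \<noteq> 0" "m2 \<noteq> 0" "a powi m1 = b powi m2" by blast
    then show "\<exists>r1 r2. least_relation a b r1 r2" by (rule least_relation_exists)
  next
    fix r1 r2 d s1 s2
    assume h1: "h1 n a b c P = 0 \<and> (\<exists>m1 m2. m1 \<noteq> 0 \<and> m2 \<noteq> 0 \<and> a powi m1 = b powi m2)"
      and r: "least_relation a b r1 r2 \<and> d = gcd r1 r2 \<and> r1 = d * s1 \<and> r2 = d * s2"
    obtain m1 m2 where m: "m1 \<noteq> 0" "m2 \<noteq> 0" "a powi m1 = b powi m2" using h1 by blast
    then have "(m1, m2) \<in> range (\<lambda>k. (k * r1, k * r2))"
      using r unfolding least_relation_def by blast
    then have "r1 \<noteq> 0" "r2 \<noteq> 0" using m(1,2) by auto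
    have d_eq: "d = gcd r1 r2" "r1 = d * s1" "r2 = d * s2" using r by blast+
    have s: "s1 \<noteq> 0" "s2 \<noteq> 0"
      using d_eq(2,3) \<open>r1 \<noteq> 0\<close> \<open>r2 \<noteq> 0\<close> by (metis mult_zero_right)+
    have d: "d > 0" unfolding d_eq(1) using \<open>r1 \<noteq> 0\<close> by simp
    have h: "poly (h1 n a b c P) (v + c / (1 - b)) = 0" for v using h1 by simp
    have least: "least_relation a b (d * s1) (d * s2)" using r d_eq by metis
    note res = resonant[OF h least d s]
    show "equivariant_map \<phi> (monomial_map xt yt s1 s2)" by (rule res(1))
    show "lattice_support \<phi> = UNIV" by (rule res(2))
    show "\<exists>\<U>. (\<forall>U\<in>\<U>. union_of_fibers (monomial_map xt yt s1 s2) U) \<and>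
        generates_lattice (\<U> \<union> {vanishing {xt, yt}}) \<phi>" if "s1 * s2 > 0"
      by (rule res(3)[OF that])
    show "\<exists>\<U>. (\<forall>U\<in>\<U>. union_of_fibers (monomial_map xt yt s1 s2) U) \<and>
        generates_lattice (\<U> \<union> {vanishing {xt}, vanishing {yt}, vanishing {xt, yt}}) \<phi>"
      if "s1 * s2 < 0"
      by (rule res(4)[OF that])
  next
    assume "h1 n a b c P = 0 \<and> \<not> (\<exists>m1 m2. m1 \<noteq> 0 \<and> m2 \<noteq> 0 \<and> a powi m1 = b powi m2)"
    then show gen: "generates_lattice {vanishing {xt}, vanishing {yt}, vanishing {xt, yt}} \<phi>"
      by (intro generated_by_axes_and_origin) simp_all
    show "finite (invariant_lattice \<phi>)" by (rule finite_invariant_lattice[OF _ gen]) simp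
    show "card {vanishing {xt}, vanishing {yt}, vanishing {xt, yt}} = 3"
      by (rule distinct_generators)
  next
    assume "h1 n a b c P \<noteq> 0"
    then obtain i where "a = b ^ i" "\<And>v. v \<noteq> 0 \<Longrightarrow> poly (h1 n a b c P) (v + c / (1 - b)) \<noteq> 0"
      using h1_monomial[of n a b c P] assms by metis
    then show gen: "generates_lattice {vanishing {yt}, vanishing {xt, yt}} \<phi>"
      by (rule generated_by_y_axis_and_origin)
    show "finite (invariant_lattice \<phi>)" by (rule finite_invariant_lattice[OF _ gen]) simp
    show "card {vanishing {yt}, vanishing {xt, yt}} = 2" by (rule distinct_generators)
  qed
qed

end
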